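(* Let $A$ be a noetherian commutative $\mathbb N$-graded ring, $\mathfrak m=A_+$, and $I=(a_1,\dots,a_n)$ an ideal of $A$ such that $\mathrm{depth}_{\mathfrak m}(A)>\mathrm{depth}_I(A)=n-1$. Let $Z_1\subset A^n$ be the module of syzygies $\{(x_1,\dots,x_n):\sum x_ia_i=0\}$ and $B_1\subset Z_1$ the submodule of Koszul syzygies (generated by $a_je_i-a_ie_j$). Then the following are equivalent: (a) $B_1=Z_1\cap I\cdot A^n$; (b) $B_1=Z_1\cap\mathrm{TF}_{\mathfrak m}(I)\cdot A^n$; (c) $I$ is syzygetic.
   Context: $\mathrm{TF}_{\mathfrak m}(I)=\{a\in A:\exists m,\ a\mathfrak m^m\subset I\}$ (the saturation of $I$). $I$ is syzygetic if the kernel $\delta(I)$ of the canonical surjection $\mathrm{Sym}^2_A(I)\to I^2$ is zero. $\mathrm{depth}_{\mathfrak a}(A)$ is the grade of $\mathfrak a$. *)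

theory Defs
  imports Main "HOL-Library.Extended_Nat" "HOL-Library.Function_Algebras"
begin

definition is_ideal :: "'a::comm_ring_1 set \<Rightarrow> bool" where
  "is_ideal J \<longleftrightarrow> 0 \<in> J \<and> (\<forall>x\<in>J. \<forall>y\<in>J. x + y \<in> J) \<and> (\<forall>r x. x \<in> J \<longrightarrow> r * x \<in> J)"

definition ideal_gen :: "'a::comm_ring_1 set \<Rightarrow> 'a set" where
  "ideal_gen S = {x. \<exists>F c. finite F \<and> F \<subseteq> S \<and> x = (\<Sum>s\<in>F. c s * s)}"

definition ideal_mult :: "'a::comm_ring_1 set \<Rightarrow> 'a set \<Rightarrow> 'a set" where
  "ideal_mult J K = ideal_gen {x * y | x y. x \<in> J \<and> y \<in> K}"

fun ideal_pow :: "'a::comm_ring_1 set \<Rightarrow> nat \<Rightarrow> 'a set" where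
  "ideal_pow J 0 = UNIV"
| "ideal_pow J (Suc k) = ideal_mult J (ideal_pow J k)"

definition noetherian_ring :: "'a::comm_ring_1 itself \<Rightarrow> bool" where
  "noetherian_ring _ \<longleftrightarrow> (\<forall>J::'a set. is_ideal J \<longrightarrow> (\<exists>F. finite F \<and> J = ideal_gen F))"

definition TF :: "'a::comm_ring_1 set \<Rightarrow> 'a set \<Rightarrow> 'a set" where
  "TF m I = {a. \<exists>k. \<forall>y \<in> ideal_pow m k. a * y \<in> I}"

definition nat_graded :: "(nat \<Rightarrow> 'a::comm_ring_1 set) \<Rightarrow> bool" where
  "nat_graded G \<longleftrightarrow>
     (\<forall>i. 0 \<in> G i \<and> (\<forall>x\<in>G i. \<forall>y\<in>G i. x + y \<in> G i) \<and> (\<forall>x\<in>G i. - x \<in> G i)) \<and>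
     (\<forall>i j. \<forall>x\<in>G i. \<forall>y\<in>G j. x * y \<in> G (i + j)) \<and>
     (\<forall>x. \<exists>!h::nat \<Rightarrow> 'a. finite {i. h i \<noteq> 0} \<and> (\<forall>i. h i \<in> G i) \<and>
                          x = (\<Sum>i\<in>{i. h i \<noteq> 0}. h i))"

definition irrelevant :: "(nat \<Rightarrow> 'a::comm_ring_1 set) \<Rightarrow> 'a set" where
  "irrelevant G = {x. \<exists>F h. finite F \<and> F \<subseteq> {1..} \<and> (\<forall>i\<in>F. h i \<in> G i) \<and> x = (\<Sum>i\<in>F. h i)}"

definition regular_seq :: "'a::comm_ring_1 list \<Rightarrow> bool" where
  "regular_seq xs \<longleftrightarrow>
     (\<forall>i < length xs. \<forall>y. xs ! i * y \<in> ideal_gen (set (take i xs)) \<longrightarrow> y \<in> ideal_gen (set (take i xs))) \<and>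
     ideal_gen (set xs) \<noteq> UNIV"

definition grade :: "'a::comm_ring_1 set \<Rightarrow> enat" where
  "grade J = (if J = UNIV then \<infinity>
              else Sup {enat (length xs) | xs. regular_seq xs \<and> set xs \<subseteq> J})"

definition freemod :: "nat \<Rightarrow> (nat \<Rightarrow> 'a::comm_ring_1) set" where
  "freemod n = {x. \<forall>i\<ge>n. x i = 0}"

definition submod_gen :: "(nat \<Rightarrow> 'a::comm_ring_1) set \<Rightarrow> (nat \<Rightarrow> 'a) set" where
  "submod_gen S = {x. \<exists>F c. finite F \<and> F \<subseteq> S \<and> x = (\<Sum>v\<in>F. (\<lambda>k. c v * v k))}"

definition syzygies :: "nat \<Rightarrow> (nat \<Rightarrow> 'a::comm_ring_1) \<Rightarrow> (nat \<Rightarrow> 'a) set" where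
  "syzygies n a = {x \<in> freemod n. (\<Sum>i<n. x i * a i) = 0}"

definition koszul_syz :: "(nat \<Rightarrow> 'a::comm_ring_1) \<Rightarrow> nat \<Rightarrow> nat \<Rightarrow> (nat \<Rightarrow> 'a)" where
  "koszul_syz a i j = (\<lambda>k. (if k = i then a j else 0) - (if k = j then a i else 0))"

definition koszul_syzygies :: "nat \<Rightarrow> (nat \<Rightarrow> 'a::comm_ring_1) \<Rightarrow> (nat \<Rightarrow> 'a) set" where
  "koszul_syzygies n a = submod_gen {koszul_syz a i j | i j. i < n \<and> j < n}"

definition ideal_freemod :: "'a::comm_ring_1 set \<Rightarrow> nat \<Rightarrow> (nat \<Rightarrow> 'a) set" where
  "ideal_freemod J n = {x \<in> freemod n. \<forall>i<n. x i \<in> J}"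

text \<open>\<open>Sym^2_A(I) = (I \<otimes>_A I)/\<langle>x\<otimes>y - y\<otimes>x\<rangle>\<close> presented as the free abelian group on
  \<open>I \<times> I\<close> (finitely supported \<open>int\<close>-valued functions) modulo the subgroup generated by
  biadditivity, A-balancedness and symmetry relations.\<close>
definition fsym :: "'a \<times> 'a \<Rightarrow> ('a \<times> 'a \<Rightarrow> int)" where
  "fsym p = (\<lambda>q. if q = p then 1 else 0)"

inductive_set sym2_rel :: "'a::comm_ring_1 set \<Rightarrow> ('a \<times> 'a \<Rightarrow> int) set" for I where
  zero: "(\<lambda>_. 0) \<in> sym2_rel I"
| add: "u \<in> sym2_rel I \<Longrightarrow> v \<in> sym2_rel I \<Longrightarrow> u + v \<in> sym2_rel I"
| neg: "u \<in> sym2_rel I \<Longrightarrow> - u \<in> sym2_rel I"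
| addl: "x \<in> I \<Longrightarrow> x' \<in> I \<Longrightarrow> y \<in> I \<Longrightarrow>
           fsym (x + x', y) - fsym (x, y) - fsym (x', y) \<in> sym2_rel I"
| addr: "x \<in> I \<Longrightarrow> y \<in> I \<Longrightarrow> y' \<in> I \<Longrightarrow>
           fsym (x, y + y') - fsym (x, y) - fsym (x, y') \<in> sym2_rel I"
| scal: "x \<in> I \<Longrightarrow> y \<in> I \<Longrightarrow> fsym (r * x, y) - fsym (x, r * y) \<in> sym2_rel I"
| symm: "x \<in> I \<Longrightarrow> y \<in> I \<Longrightarrow> fsym (x, y) - fsym (y, x) \<in> sym2_rel I"

text \<open>I is syzygetic iff the kernel of \<open>Sym^2(I) \<rightarrow> I^2\<close>, \<open>[x y] \<mapsto> x y\<close>, is zero: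
  every formal combination over \<open>I \<times> I\<close> mapping to 0 lies in the relation subgroup.\<close>
definition syzygetic :: "'a::comm_ring_1 set \<Rightarrow> bool" where
  "syzygetic I \<longleftrightarrow>
     (\<forall>f::'a \<times> 'a \<Rightarrow> int. finite {p. f p \<noteq> 0} \<and> {p. f p \<noteq> 0} \<subseteq> I \<times> I \<and>
        (\<Sum>p\<in>{p. f p \<noteq> 0}. of_int (f p) * fst p * snd p) = 0
        \<longrightarrow> f \<in> sym2_rel I)"

end

theory Submission
  imports Defs
begin

text \<open>
  (a) \<open>\<Leftrightarrow>\<close> (c) holds for every ideal: sending \<open>x y\<close> to \<open>r y\<close>, where \<open>x = \<Sum> r\<^sub>i a\<^sub>i\<close>, identifies
  the kernel of \<open>Sym\<^sup>2(I) \<rightarrow> I\<^sup>2\<close> with \<open>(Z\<^sub>1 \<inter> I A\<^sup>n)/B\<^sub>1\<close>.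

  For (a) \<open>\<Rightarrow>\<close> (b), a syzygy \<open>z\<close> with entries in the saturation of \<open>I\<close> satisfies
  \<open>m\<^sup>k z \<subseteq> Z\<^sub>1 \<inter> I A\<^sup>n = B\<^sub>1\<close>, so it suffices that no nonzero class of \<open>H\<^sub>1(a) = Z\<^sub>1/B\<^sub>1\<close> is
  annihilated by \<open>m\<close>. Let \<open>x\<close> be a regular sequence of length \<open>n - 1\<close> in \<open>I\<close>. Dividing out its
  members one at a time, each killing Koszul homology, transports such a class to one in
  \<open>H\<^sub>n(a; A/(x)) \<subseteq> A/(x)\<close>. Finally \<open>A/(x)\<close> has no element annihilated by \<open>m\<close>: for a regular
  sequence \<open>y\<close> of length \<open>n\<close> in \<open>m\<close>, the Koszul homology \<open>H\<^sub>i(y; A/(x\<^sub>1, \<dots>, x\<^sub>j))\<close> vanishes for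
  \<open>i > j\<close>, and \<open>H\<^sub>n(y; A/(x))\<close> is the annihilator of \<open>y\<close> in \<open>A/(x)\<close>.
\<close>

section \<open>Ideals\<close>

lemma is_ideal_zero: "is_ideal J \<Longrightarrow> 0 \<in> J"
  and is_ideal_add: "is_ideal J \<Longrightarrow> x \<in> J \<Longrightarrow> y \<in> J \<Longrightarrow> x + y \<in> J"
  and is_ideal_mult: "is_ideal J \<Longrightarrow> x \<in> J \<Longrightarrow> r * x \<in> J"
  by (auto simp: is_ideal_def)

lemma is_idealI:
  assumes "0 \<in> J" "\<And>x y. x \<in> J \<Longrightarrow> y \<in> J \<Longrightarrow> x + y \<in> J" "\<And>r x. x \<in> J \<Longrightarrow> r * x \<in> J"
  shows "is_ideal J"
  using assms by (auto simp: is_ideal_def)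

lemma is_ideal_uminus:
  assumes "is_ideal J" "x \<in> J"
  shows "- x \<in> J"
  using is_ideal_mult[OF assms, of "-1"] by simp

lemma is_ideal_sum:
  assumes "is_ideal J" "\<And>i. i \<in> F \<Longrightarrow> f i \<in> J"
  shows "sum f F \<in> J"
  using assms(2)
  by (induction F rule: infinite_finite_induct)
     (auto intro: is_ideal_zero[OF assms(1)] is_ideal_add[OF assms(1)])

lemma ideal_genI:
  assumes "finite F" "F \<subseteq> S"
  shows "(\<Sum>s\<in>F. c s * s) \<in> ideal_gen S"
  using assms unfolding ideal_gen_def by blast

lemma ideal_gen_base: "x \<in> S \<Longrightarrow> x \<in> ideal_gen S"
  using ideal_genI[of "{x}" S "\<lambda>_. 1"] by simp

lemma is_ideal_ideal_gen: "is_ideal (ideal_gen S)"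
  unfolding is_ideal_def
proof (intro conjI ballI allI impI)
  show "0 \<in> ideal_gen S" using ideal_genI[of "{}" S "\<lambda>_. 0"] by simp
next
  fix x y assume "x \<in> ideal_gen S" "y \<in> ideal_gen S"
  then obtain F c H e where F: "finite F" "F \<subseteq> S" "x = (\<Sum>s\<in>F. c s * s)"
    and H: "finite H" "H \<subseteq> S" "y = (\<Sum>s\<in>H. e s * s)" unfolding ideal_gen_def by blast
  define c' where "c' s = (if s \<in> F then c s else 0)" for s
  define e' where "e' s = (if s \<in> H then e s else 0)" for s
  have "x = (\<Sum>s\<in>F \<union> H. c' s * s)" unfolding F(3)
    by (rule sum.mono_neutral_cong_left) (use F(1) H(1) in \<open>auto simp: c'_def\<close>)
  moreover have "y = (\<Sum>s\<in>F \<union> H. e' s * s)" unfolding H(3)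
    by (rule sum.mono_neutral_cong_left) (use F(1) H(1) in \<open>auto simp: e'_def\<close>)
  ultimately have "x + y = (\<Sum>s\<in>F \<union> H. (c' s + e' s) * s)"
    by (simp add: sum.distrib distrib_right)
  then show "x + y \<in> ideal_gen S"
    using ideal_genI[of "F \<union> H" S "\<lambda>s. c' s + e' s"] F H by simp
next
  fix r x assume "x \<in> ideal_gen S"
  then obtain F c where F: "finite F" "F \<subseteq> S" "x = (\<Sum>s\<in>F. c s * s)"
    unfolding ideal_gen_def by blast
  then have "r * x = (\<Sum>s\<in>F. (r * c s) * s)" by (simp add: sum_distrib_left mult.assoc)
  then show "r * x \<in> ideal_gen S" using ideal_genI[of F S "\<lambda>s. r * c s"] F by simp
qed

lemma ideal_gen_least:
  assumes "is_ideal J" "S \<subseteq> J"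
  shows "ideal_gen S \<subseteq> J"
  unfolding ideal_gen_def using assms by (auto intro!: is_ideal_sum is_ideal_mult)

lemma ideal_gen_empty: "ideal_gen {} = {0}"
  unfolding ideal_gen_def by auto

lemma ideal_gen_mono: "S \<subseteq> T \<Longrightarrow> ideal_gen S \<subseteq> ideal_gen T"
  by (rule ideal_gen_least[OF is_ideal_ideal_gen]) (auto intro: ideal_gen_base)

text \<open>The elements congruent to a multiple of \<open>x\<close> modulo
  \<open>ideal_gen S\<close> form an ideal that contains \<open>x\<close> and
  \<open>S\<close>.\<close>

lemma ideal_gen_insertE:
  assumes "y \<in> ideal_gen (insert x S)"
  obtains r where "y - x * r \<in> ideal_gen S"
proof -
  let ?J = "{y. \<exists>r. y - x * r \<in> ideal_gen S}"
  note I = is_ideal_ideal_gen[of S]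
  have "is_ideal ?J" unfolding is_ideal_def
  proof (intro conjI ballI allI impI; clarsimp)
    show "\<exists>r. - (x * r) \<in> ideal_gen S" by (rule exI[of _ 0]) (simp add: is_ideal_zero[OF I])
  next
    fix y r z q assume "y - x * r \<in> ideal_gen S" "z - x * q \<in> ideal_gen S"
    from is_ideal_add[OF I this] show "\<exists>r. y + z - x * r \<in> ideal_gen S"
      by (intro exI[of _ "r + q"]) (simp add: algebra_simps)
  next
    fix c y r assume "y - x * r \<in> ideal_gen S"
    from is_ideal_mult[OF I this, of c] show "\<exists>r. c * y - x * r \<in> ideal_gen S"
      by (intro exI[of _ "c * r"]) (simp add: algebra_simps)
  qed
  moreover have "insert x S \<subseteq> ?J"
  proof (intro subsetI CollectI)
    fix y assume "y \<in> insert x S"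
    then consider "y = x" | "y \<in> S" by blast
    then show "\<exists>r. y - x * r \<in> ideal_gen S"
    proof cases
      case 1 then show ?thesis by (intro exI[of _ 1]) (simp add: is_ideal_zero[OF I])
    next
      case 2 then show ?thesis by (intro exI[of _ 0]) (simp add: ideal_gen_base)
    qed
  qed
  ultimately have "ideal_gen (insert x S) \<subseteq> ?J" by (rule ideal_gen_least)
  with assms that show thesis by blast
qed

lemma ideal_gen_insertI:
  assumes "y - x * r \<in> ideal_gen S"
  shows "y \<in> ideal_gen (insert x S)"
proof -
  note I = is_ideal_ideal_gen[of "insert x S"]
  have "r * x \<in> ideal_gen (insert x S)" by (rule is_ideal_mult[OF I]) (simp add: ideal_gen_base)
  moreover have "y - x * r \<in> ideal_gen (insert x S)" using assms ideal_gen_mono[of S "insert x S"] by blast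
  ultimately show ?thesis using is_ideal_add[OF I, of "r * x" "y - x * r"] by (simp add: mult.commute)
qed

text \<open>The family \<open>a\<close> may repeat values, so sums over subsets of its image are
  traded for sums over indices: the latter form an ideal containing every
  \<open>a i\<close>.\<close>

lemma ideal_gen_imageE:
  fixes a :: "nat \<Rightarrow> 'a::comm_ring_1"
  assumes "y \<in> ideal_gen (a ` {..<n})"
  obtains r where "y = (\<Sum>i<n. r i * a i)"
proof -
  let ?J = "{y. \<exists>r. y = (\<Sum>i<n. r i * a i)}"
  have "is_ideal ?J"
  proof (rule is_idealI)
    show "0 \<in> ?J" by (auto intro!: exI[of _ "\<lambda>_. 0"])
  next
    fix x y assume "x \<in> ?J" "y \<in> ?J"
    then obtain r q where "x = (\<Sum>i<n. r i * a i)" "y = (\<Sum>i<n. q i * a i)" by blast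
    then have "x + y = (\<Sum>i<n. (r i + q i) * a i)" by (simp add: algebra_simps sum.distrib)
    then show "x + y \<in> ?J" by (auto intro!: exI[of _ "\<lambda>i. r i + q i"])
  next
    fix c x assume "x \<in> ?J"
    then obtain r where "x = (\<Sum>i<n. r i * a i)" by blast
    then have "c * x = (\<Sum>i<n. (c * r i) * a i)" by (simp add: sum_distrib_left mult.assoc)
    then show "c * x \<in> ?J" by (auto intro!: exI[of _ "\<lambda>i. c * r i"])
  qed
  moreover have "a ` {..<n} \<subseteq> ?J"
  proof (intro subsetI CollectI)
    fix y assume "y \<in> a ` {..<n}"
    then obtain j where "j < n" "y = a j" by blast
    then show "\<exists>r. y = (\<Sum>i<n. r i * a i)"
      by (intro exI[of _ "\<lambda>i. if i = j then 1 else 0"]) (simp add: if_distrib[of "\<lambda>c. c * _"] cong: if_cong)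
  qed
  ultimately have "ideal_gen (a ` {..<n}) \<subseteq> ?J" by (rule ideal_gen_least)
  with assms that show thesis by blast
qed

lemma is_ideal_ideal_pow: "is_ideal (ideal_pow m k)"
proof (cases k)
  case 0 then show ?thesis by (simp add: is_ideal_def)
next
  case (Suc l) then show ?thesis by (simp add: ideal_mult_def is_ideal_ideal_gen)
qed

lemma ideal_pow_antimono:
  assumes "k \<le> l"
  shows "ideal_pow m l \<subseteq> ideal_pow m k"
  using assms
proof (induction l rule: dec_induct)
  case (step l)
  have "ideal_pow m (Suc l) \<subseteq> ideal_pow m l"
    unfolding ideal_pow.simps ideal_mult_def
    by (rule ideal_gen_least[OF is_ideal_ideal_pow]) (auto intro: is_ideal_mult[OF is_ideal_ideal_pow])
  with step.IH show ?case by blast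
qed simp

lemma subset_TF:
  fixes J :: "'a::comm_ring_1 set"
  shows "is_ideal J \<Longrightarrow> J \<subseteq> TF m J"
  unfolding TF_def using is_ideal_mult[of J] by (fastforce simp: mult.commute)

section \<open>Regular sequences\<close>

definition weakly_regular :: "'a::comm_ring_1 list \<Rightarrow> bool" where
  "weakly_regular xs \<longleftrightarrow> (\<forall>i < length xs. \<forall>y. xs ! i * y \<in> ideal_gen (set (take i xs)) \<longrightarrow>
     y \<in> ideal_gen (set (take i xs)))"

lemma weakly_regularD:
  "weakly_regular xs \<Longrightarrow> i < length xs \<Longrightarrow> xs ! i * y \<in> ideal_gen (set (take i xs)) \<Longrightarrow>
    y \<in> ideal_gen (set (take i xs))"
  by (simp add: weakly_regular_def)

lemma weakly_regular_take: "weakly_regular xs \<Longrightarrow> weakly_regular (take k xs)"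
  unfolding weakly_regular_def by (simp add: min_def)

text \<open>The supremum in \<open>grade\<close> need not be known to be attained: some sequence has
  length at least \<open>k\<close>, and it is truncated. Properness of \<open>J\<close> excludes the
  case where the grade is infinite by convention.\<close>

lemma weakly_regular_of_grade:
  assumes "enat k \<le> grade J" "J \<noteq> UNIV"
  obtains xs where "length xs = k" "weakly_regular xs" "set xs \<subseteq> J"
proof -
  let ?X = "{enat (length xs) | xs. regular_seq xs \<and> set xs \<subseteq> J}"
  have "\<exists>xs. k \<le> length xs \<and> weakly_regular xs \<and> set xs \<subseteq> J"
  proof (cases k)
    case 0 then show ?thesis by (intro exI[of _ "[]"]) (simp add: weakly_regular_def)
  next
    case (Suc l)
    have "\<exists>x\<in>?X. enat l < x"
    proof (rule ccontr)
      assume "\<not> ?thesis"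
      then have "Sup ?X \<le> enat l" by (intro Sup_least) (auto simp: not_less)
      moreover have "enat (Suc l) \<le> Sup ?X" using assms Suc by (simp add: grade_def)
      ultimately have "enat (Suc l) \<le> enat l" by (rule order_trans[rotated])
      then show False by simp
    qed
    then show ?thesis using Suc by (auto simp: regular_seq_def weakly_regular_def Suc_le_eq)
  qed
  then obtain xs where "k \<le> length xs" "weakly_regular xs" "set xs \<subseteq> J" by blast
  then show thesis
    using that[of "take k xs"] weakly_regular_take set_take_subset[of k xs] by fastforce
qed

section \<open>The Koszul complex\<close>

text \<open>The sign of sorting \<open>e_i \<and> e_T\<close> into increasing order, for
  \<open>i\<close> outside \<open>T\<close>.\<close>

definition ksign :: "nat \<Rightarrow> nat set \<Rightarrow> 'a::comm_ring_1" where
  "ksign i T = (-1) ^ card {t \<in> T. t < i}"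

text \<open>A Koszul chain of degree \<open>p\<close> is given by its coefficients on the basis
  \<open>e\<^sub>T = e\<^bsub>t\<^sub>1\<^esub> \<and> \<dots> \<and> e\<^bsub>t\<^sub>p\<^esub>\<close> of the exterior power, where \<open>T = {t\<^sub>1 < \<dots> < t\<^sub>p}\<close>.\<close>
definition kchain :: "nat \<Rightarrow> nat \<Rightarrow> (nat set \<Rightarrow> 'a::comm_ring_1) set" where
  "kchain n p = {z. \<forall>T. z T \<noteq> 0 \<longrightarrow> T \<subseteq> {..<n} \<and> card T = p}"

text \<open>Contraction with the form \<open>e_i \<mapsto> a i\<close>, read coefficientwise: the
  coefficient at \<open>T\<close> collects what each \<open>e_(insert i T)\<close> sends
  there.\<close>

definition kdiff :: "nat \<Rightarrow> (nat \<Rightarrow> 'a::comm_ring_1) \<Rightarrow> (nat set \<Rightarrow> 'a) \<Rightarrow> nat set \<Rightarrow> 'a" where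
  "kdiff n a z T = (\<Sum>i<n. if i \<in> T then 0 else ksign i T * a i * z (insert i T))"

text \<open>Left exterior multiplication by the vector \<open>\<Sum> h_i e_i\<close>.\<close>

definition kwedge :: "nat \<Rightarrow> (nat \<Rightarrow> 'a::comm_ring_1) \<Rightarrow> (nat set \<Rightarrow> 'a) \<Rightarrow> nat set \<Rightarrow> 'a" where
  "kwedge n h z T = (\<Sum>i<n. if i \<in> T then ksign i T * h i * z (T - {i}) else 0)"

lemma ksign_insert:
  assumes "j \<notin> T"
  shows "ksign i (insert j T) = (if j < i then - ksign i T else ksign i T :: 'a::comm_ring_1)"
proof -
  have "{t \<in> insert j T. t < i} = (if j < i then insert j {t \<in> T. t < i} else {t \<in> T. t < i})" by auto
  then show ?thesis using assms by (simp add: ksign_def)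
qed

lemma ksign_remove:
  assumes "j \<in> T"
  shows "ksign i (T - {j}) = (if j < i then - ksign i T else ksign i T :: 'a::comm_ring_1)"
  using ksign_insert[of j "T - {j}" i, where 'a='a] assms by (auto simp: insert_absorb split: if_splits)

lemma ksign_square: "ksign i T * ksign i T = (1 :: 'a::comm_ring_1)"
  by (simp add: ksign_def flip: power_mult_distrib)

lemma kdiff_add: "kdiff n a (\<lambda>T. z T + w T) T = kdiff n a z T + kdiff n a w T"
  unfolding kdiff_def sum.distrib[symmetric] by (rule sum.cong) (auto simp: algebra_simps)

lemma kdiff_scale: "kdiff n a (\<lambda>T. c * z T) T = c * kdiff n a z T"
  unfolding kdiff_def sum_distrib_left by (rule sum.cong) (auto simp: algebra_simps)

lemma kdiff_diff: "kdiff n a (\<lambda>T. z T - w T) T = kdiff n a z T - kdiff n a w T"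
  using kdiff_add[of n a z "\<lambda>T. - 1 * w T" T] kdiff_scale[of n a "-1" w T] by simp

lemma kwedge_scale: "kwedge n h (\<lambda>T. c * z T) T = c * kwedge n h z T"
  unfolding kwedge_def sum_distrib_left by (rule sum.cong) (auto simp: algebra_simps)

lemma kwedge_diff: "kwedge n h (\<lambda>T. z T - w T) T = kwedge n h z T - kwedge n h w T"
  unfolding kwedge_def sum_subtractf[symmetric] by (rule sum.cong) (auto simp: algebra_simps)

lemma kdiff_in_ideal: "is_ideal J \<Longrightarrow> (\<And>T. z T \<in> J) \<Longrightarrow> kdiff n a z T \<in> J"
  unfolding kdiff_def by (auto intro!: is_ideal_sum is_ideal_mult is_ideal_zero)

lemma kwedge_in_ideal: "is_ideal J \<Longrightarrow> (\<And>T. z T \<in> J) \<Longrightarrow> kwedge n h z T \<in> J"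
  unfolding kwedge_def by (auto intro!: is_ideal_sum is_ideal_mult is_ideal_zero)

lemma kdiff_kchain:
  assumes "z \<in> kchain n (Suc p)"
  shows "kdiff n a z \<in> kchain n p"
  unfolding kchain_def
proof (intro CollectI allI impI)
  fix T assume "kdiff n a z T \<noteq> 0"
  then obtain i where i: "i \<notin> T" "z (insert i T) \<noteq> 0"
    unfolding kdiff_def by (elim sum.not_neutral_contains_not_neutral) (metis mult_zero_right)
  with assms have *: "insert i T \<subseteq> {..<n}" "card (insert i T) = Suc p" by (auto simp: kchain_def)
  then have "finite T" using finite_subset by fastforce
  with * i show "T \<subseteq> {..<n} \<and> card T = p" by simp
qed

lemma kwedge_kchain:
  assumes "z \<in> kchain n p"
  shows "kwedge n h z \<in> kchain n (Suc p)"
  unfolding kchain_def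
proof (intro CollectI allI impI)
  fix T assume "kwedge n h z T \<noteq> 0"
  then obtain i where i: "i \<in> T" "i < n" "z (T - {i}) \<noteq> 0"
    unfolding kwedge_def by (elim sum.not_neutral_contains_not_neutral) (metis lessThan_iff mult_zero_right)
  with assms have *: "T - {i} \<subseteq> {..<n}" "card (T - {i}) = p" by (auto simp: kchain_def)
  then have "finite (T - {i})" using finite_subset by blast
  then have "finite T" by simp
  with * i show "T \<subseteq> {..<n} \<and> card T = Suc p"
    using card_Suc_Diff1[of T i] by auto
qed

text \<open>Terms off the diagonal cancel in pairs; the zero diagonal is a separate condition
  because antisymmetry only gives \<open>2 * g i i = 0\<close>.\<close>

lemma alternating_double_sum:
  fixes g :: "nat \<Rightarrow> nat \<Rightarrow> 'a::comm_ring_1"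
  assumes "\<And>i. g i i = 0" "\<And>i j. g i j = - g j i"
  shows "(\<Sum>i<n. \<Sum>j<n. g i j) = 0"
proof (induction n)
  case (Suc n)
  have "(\<Sum>i<n. g i n) = - (\<Sum>j<n. g n j)"
    unfolding sum_negf[symmetric] by (rule sum.cong) (auto intro: assms(2))
  with Suc show ?case by (simp add: sum.distrib assms(1))
qed simp

text \<open>Inserting \<open>i\<close> and \<open>j\<close> in the two possible orders gives
  opposite signs, since only the larger index sees the smaller one; so the double sum is
  alternating.\<close>

lemma kdiff_kdiff: "kdiff n a (kdiff n a z) T = 0"
proof -
  define g where "g i j = (if i \<in> T \<or> j \<in> insert i T then 0 else
     ksign i T * a i * (ksign j (insert i T) * a j * z (insert j (insert i T))))" for i j
  have alt: "g i j = - g j i" for i j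
  proof (cases "i \<in> T \<or> j \<in> T \<or> i = j")
    case False
    moreover have "insert i (insert j T) = insert j (insert i T)" by auto
    ultimately show ?thesis
      by (cases "i < j") (simp_all add: g_def ksign_insert mult_ac)
  qed (auto simp: g_def)
  have "(\<Sum>i<n. \<Sum>j<n. g i j) = 0"
    by (rule alternating_double_sum[OF _ alt]) (simp add: g_def)
  moreover have "kdiff n a (kdiff n a z) T = (\<Sum>i<n. \<Sum>j<n. g i j)"
    unfolding kdiff_def by (intro sum.cong refl) (auto simp: g_def sum_distrib_left intro!: sum.cong)
  ultimately show ?thesis by simp
qed

text \<open>Contraction is an antiderivation, so multiplication by \<open>\<Sum> h_i a_i\<close> is
  null-homotopic. Off the diagonal the two composites cancel; for \<open>i = j\<close> exactly one
  of them contributes, according to whether \<open>i \<in> T\<close>.\<close>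

lemma kdiff_kwedge:
  "kdiff n a (kwedge n h z) T + kwedge n h (kdiff n a z) T = (\<Sum>i<n. h i * a i) * z T"
proof -
  define f where "f i j = (if i \<in> T \<or> j \<notin> insert i T then 0 else
     ksign i T * a i * (ksign j (insert i T) * h j * z (insert i T - {j})))" for i j
  define g where "g i j = (if j \<notin> T \<or> i \<in> T - {j} then 0 else
     ksign j T * h j * (ksign i (T - {j}) * a i * z (insert i (T - {j}))))" for i j
  have fg: "f i j + g i j = (if i = j then h i * a i * z T else 0)" for i j
  proof (cases "i = j")
    case True
    have "ksign i T * a i * (ksign i T * h i * z T) = (ksign i T * ksign i T) * (h i * a i * z T)"
      "ksign i T * h i * (ksign i T * a i * z T) = (ksign i T * ksign i T) * (h i * a i * z T)"
      by (simp_all add: algebra_simps)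
    with True show ?thesis
      by (auto simp: f_def g_def ksign_square ksign_insert ksign_remove insert_absorb)
  next
    case False
    then have "insert i T - {j} = insert i (T - {j})" by auto
    with False show ?thesis
      by (cases "i < j") (auto simp: f_def g_def ksign_insert ksign_remove algebra_simps)
  qed
  have "kdiff n a (kwedge n h z) T = (\<Sum>i<n. \<Sum>j<n. f i j)"
    unfolding kdiff_def kwedge_def
    by (intro sum.cong refl) (auto simp: f_def sum_distrib_left intro!: sum.cong)
  moreover have "kwedge n h (kdiff n a z) T = (\<Sum>j<n. \<Sum>i<n. g i j)"
    unfolding kdiff_def kwedge_def
    by (intro sum.cong refl) (auto simp: g_def sum_distrib_left intro!: sum.cong)
  moreover have "(\<Sum>j<n. \<Sum>i<n. g i j) = (\<Sum>i<n. \<Sum>j<n. g i j)" by (rule sum.swap)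
  moreover have "(\<Sum>i<n. \<Sum>j<n. f i j) + (\<Sum>i<n. \<Sum>j<n. g i j) = (\<Sum>i<n. \<Sum>j<n. f i j + g i j)"
    by (simp add: sum.distrib)
  ultimately show ?thesis by (simp add: fg sum_distrib_right)
qed

section \<open>Depth sensitivity of Koszul homology\<close>

text \<open>Chains over \<open>A/J\<close> are represented by chains over \<open>A\<close>, and
  equations between them are read modulo \<open>J\<close>.\<close>

definition kboundary ::
    "nat \<Rightarrow> (nat \<Rightarrow> 'a::comm_ring_1) \<Rightarrow> 'a set \<Rightarrow> nat \<Rightarrow> (nat set \<Rightarrow> 'a) \<Rightarrow> bool" where
  "kboundary n a J p z \<longleftrightarrow> (\<exists>u\<in>kchain n (Suc p). \<forall>T. z T - kdiff n a u T \<in> J)"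

text \<open>No nonzero class in the Koszul homology \<open>H\<^sub>p(a; A/J)\<close> is annihilated by all of \<open>S\<close>.
  For \<open>S = {}\<close> this says that \<open>H\<^sub>p(a; A/J) = 0\<close>.\<close>
definition ktorsion_free ::
    "nat \<Rightarrow> (nat \<Rightarrow> 'a::comm_ring_1) \<Rightarrow> 'a set \<Rightarrow> 'a set \<Rightarrow> nat \<Rightarrow> bool" where
  "ktorsion_free n a S J p \<longleftrightarrow> (\<forall>z\<in>kchain n p. (\<forall>T. kdiff n a z T \<in> J) \<longrightarrow>
     (\<forall>s\<in>S. kboundary n a J p (\<lambda>T. s * z T)) \<longrightarrow> kboundary n a J p z)"

lemma ktorsion_freeD:
  assumes "ktorsion_free n a S J p" "z \<in> kchain n p" "\<And>T. kdiff n a z T \<in> J"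
    and "\<And>s. s \<in> S \<Longrightarrow> kboundary n a J p (\<lambda>T. s * z T)"
  obtains u where "u \<in> kchain n (Suc p)" "\<And>T. z T - kdiff n a u T \<in> J"
  using assms unfolding ktorsion_free_def kboundary_def by metis

lemma kchain_scale: "z \<in> kchain n p \<Longrightarrow> (\<lambda>T. c * z T) \<in> kchain n p"
  unfolding kchain_def mem_Collect_eq by (metis mult_zero_right)

lemma kchain_diff: "z \<in> kchain n p \<Longrightarrow> w \<in> kchain n p \<Longrightarrow> (\<lambda>T. z T - w T) \<in> kchain n p"
  unfolding kchain_def mem_Collect_eq by (metis diff_zero)

lemma kchain_above_eq_0:
  assumes "z \<in> kchain n p" "n < p"
  shows "z T = 0"
proof (rule ccontr)
  assume "z T \<noteq> 0"
  with assms have "T \<subseteq> {..<n}" "card T = p" by (auto simp: kchain_def)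
  with card_mono[of "{..<n}" T] assms(2) show False by simp
qed

lemma kchain_quotient:
  assumes "v \<in> kchain n p" "\<And>T. v T \<in> ideal_gen (insert x X)"
  obtains t where "t \<in> kchain n p" "\<And>T. v T - x * t T \<in> ideal_gen X"
proof -
  have "\<exists>r. v T - x * r \<in> ideal_gen X" for T using ideal_gen_insertE[OF assms(2)] by metis
  then obtain r where r: "\<And>T. v T - x * r T \<in> ideal_gen X" by metis
  show thesis
  proof (rule that)
    \<comment> \<open>The quotient is set to 0 wherever \<open>v\<close> vanishes, so that its
      support stays within that of \<open>v\<close>.\<close>
    show "(\<lambda>T. if v T = 0 then 0 else r T) \<in> kchain n p" using assms(1) by (auto simp: kchain_def)
    show "v T - x * (if v T = 0 then 0 else r T) \<in> ideal_gen X" for T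
      using r[of T] is_ideal_zero[OF is_ideal_ideal_gen] by auto
  qed
qed

text \<open>Since \<open>x\<close> lies in the ideal generated by \<open>a\<close>, it kills Koszul homology, so the connecting
  map \<open>H\<^bsub>p+1\<^esub>(a; A/(X,x)) \<rightarrow> H\<^sub>p(a; A/X)\<close> is surjective. A preimage of the class of \<open>z\<close> is the
  class of \<open>h \<and> z\<close>, which inherits the annihilators of \<open>z\<close>.\<close>
lemma ktorsion_free_descend:
  assumes x: "x = (\<Sum>i<n. h i * a i)"
    and nzd: "\<And>y. x * y \<in> ideal_gen X \<Longrightarrow> y \<in> ideal_gen X"
    and tf: "ktorsion_free n a S (ideal_gen (insert x X)) (Suc p)"
  shows "ktorsion_free n a S (ideal_gen X) p"
  unfolding ktorsion_free_def
proof (intro ballI impI)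
  let ?J = "ideal_gen X" and ?J' = "ideal_gen (insert x X)"
  note J = is_ideal_ideal_gen[of X]
  fix z assume z: "z \<in> kchain n p" and cyc: "\<forall>T. kdiff n a z T \<in> ?J"
    and ann: "\<forall>s\<in>S. kboundary n a ?J p (\<lambda>T. s * z T)"
  let ?w = "kwedge n h z"
  have dw: "x * z T - kdiff n a ?w T \<in> ?J" for T
  proof -
    have "x * z T - kdiff n a ?w T = kwedge n h (kdiff n a z) T"
      using kdiff_kwedge[of n a h z T] x by (simp add: algebra_simps)
    then show ?thesis using kwedge_in_ideal[OF J] cyc by simp
  qed
  have wcyc: "kdiff n a ?w T \<in> ?J'" for T
  proof (rule ideal_gen_insertI)
    show "kdiff n a ?w T - x * z T \<in> ?J" using is_ideal_uminus[OF J dw[of T]] by simp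
  qed
  have wann: "kboundary n a ?J' (Suc p) (\<lambda>T. s * ?w T)" if s: "s \<in> S" for s
  proof -
    obtain v where v: "v \<in> kchain n (Suc p)" "\<And>T. s * z T - kdiff n a v T \<in> ?J"
      using ann s unfolding kboundary_def by blast
    \<comment> \<open>Modulo \<open>X\<close>, if \<open>s z = d v\<close> then the homotopy formula
      gives \<open>s (h \<and> z) = h \<and> d v = x v - d (h \<and> v)\<close>, a boundary modulo
      \<open>x\<close>.\<close>
    have "s * ?w T - kdiff n a (\<lambda>T. - 1 * kwedge n h v T) T \<in> ?J'" for T
    proof (rule ideal_gen_insertI)
      have "s * ?w T - kdiff n a (\<lambda>T. - 1 * kwedge n h v T) T - x * v T
          = kwedge n h (\<lambda>T. s * z T - kdiff n a v T) T"
        using kdiff_kwedge[of n a h v T] x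
        unfolding kdiff_scale kwedge_diff kwedge_scale by (simp add: algebra_simps)
      also have "\<dots> \<in> ?J" using kwedge_in_ideal[OF J] v(2) by simp
      finally show "s * ?w T - kdiff n a (\<lambda>T. - 1 * kwedge n h v T) T - x * v T \<in> ?J" .
    qed
    then show ?thesis
      unfolding kboundary_def using kchain_scale[OF kwedge_kchain[OF v(1)]] by blast
  qed
  obtain u where u: "u \<in> kchain n (Suc (Suc p))" "\<And>T. ?w T - kdiff n a u T \<in> ?J'"
    using ktorsion_freeD[OF tf kwedge_kchain[OF z] wcyc wann] by blast
  \<comment> \<open>Triviality of the class of \<open>h \<and> z\<close> makes
    \<open>?w - d u\<close> equal to \<open>x t\<close> modulo \<open>X\<close>; applying
    \<open>d\<close> gives \<open>x z = x d t\<close>, and \<open>x\<close> cancels.\<close>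
  obtain t where t: "t \<in> kchain n (Suc p)" "\<And>T. (?w T - kdiff n a u T) - x * t T \<in> ?J"
    using kchain_quotient[OF kchain_diff[OF kwedge_kchain[OF z] kdiff_kchain[OF u(1)]] u(2)] by blast
  have "z T - kdiff n a t T \<in> ?J" for T
  proof (rule nzd)
    have "kdiff n a (\<lambda>T. (?w T - kdiff n a u T) - x * t T) T \<in> ?J" by (rule kdiff_in_ideal[OF J t(2)])
    then have "kdiff n a ?w T - x * kdiff n a t T \<in> ?J"
      unfolding kdiff_diff kdiff_scale kdiff_kdiff by simp
    from is_ideal_add[OF J this dw[of T]] show "x * (z T - kdiff n a t T) \<in> ?J"
      by (simp add: algebra_simps)
  qed
  with t(1) show "kboundary n a ?J p z" unfolding kboundary_def by blast
qed

text \<open>Each member of \<open>xs\<close> removed from the modulus lowers the homological degree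
  by one.\<close>

lemma ktorsion_free_descend_list:
  assumes "weakly_regular xs" "set xs \<subseteq> ideal_gen (a ` {..<n})"
    and "ktorsion_free n a S (ideal_gen (set xs)) (p + length xs)"
  shows "ktorsion_free n a S {0} p"
proof -
  have "ktorsion_free n a S {0} p"
    if "j \<le> length xs" "ktorsion_free n a S (ideal_gen (set (take j xs))) (p + j)" for j
    using that
  proof (induction j)
    case 0 then show ?case by (simp add: ideal_gen_empty)
  next
    case (Suc j)
    then have j: "j < length xs" by simp
    then have "xs ! j \<in> ideal_gen (a ` {..<n})" using assms(2) by auto
    then obtain h where h: "xs ! j = (\<Sum>i<n. h i * a i)" by (rule ideal_gen_imageE)
    have "set (take (Suc j) xs) = insert (xs ! j) (set (take j xs))"
      using j by (simp add: take_Suc_conv_app_nth)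
    with Suc.prems(2)
    have "ktorsion_free n a S (ideal_gen (insert (xs ! j) (set (take j xs)))) (Suc (p + j))" by simp
    with weakly_regularD[OF assms(1) j] have "ktorsion_free n a S (ideal_gen (set (take j xs))) (p + j)"
      by (rule ktorsion_free_descend[OF h])
    with Suc.IH j show ?case by simp
  qed
  from this[of "length xs"] assms(3) show ?thesis by simp
qed

section \<open>Vanishing of Koszul homology for regular sequences and their quotients\<close>

lemma ktorsion_free_above:
  fixes a :: "nat \<Rightarrow> 'a::comm_ring_1"
  shows "n < p \<Longrightarrow> is_ideal J \<Longrightarrow> ktorsion_free n a S J p"
  unfolding ktorsion_free_def kboundary_def
proof (intro ballI impI bexI[of _ "\<lambda>_. 0"] allI)
  fix z :: "nat set \<Rightarrow> 'a" and T assume "n < p" "is_ideal J" "z \<in> kchain n p"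
  then show "z T - kdiff n a (\<lambda>_. 0) T \<in> J"
    by (simp add: kchain_above_eq_0[of z n p] kdiff_def is_ideal_zero cong: if_cong)
qed (simp add: kchain_def)

text \<open>The members of \<open>ys\<close> lie in the ideal they generate, so vanishing descends
  from degree \<open>p + length ys\<close>, where every chain is zero.\<close>

lemma koszul_acyclic:
  assumes "weakly_regular ys" "0 < p"
  shows "ktorsion_free (length ys) ((!) ys) {} {0} p"
proof (rule ktorsion_free_descend_list[OF assms(1)])
  show "set ys \<subseteq> ideal_gen ((!) ys ` {..<length ys})"
    by (auto simp: in_set_conv_nth intro!: ideal_gen_base)
qed (use assms(2) in \<open>simp add: ktorsion_free_above is_ideal_ideal_gen\<close>)

text \<open>This is exactness of \<open>H_(p+1)(A/X) \<rightarrow> H_(p+1)(A/(X,x)) \<rightarrow>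
  H_p(A/X)\<close>, from the long exact sequence of multiplication by \<open>x\<close> on
  \<open>A/X\<close>: both outer terms vanish.\<close>

lemma koszul_homology_quotient_zero:
  assumes nzd: "\<And>y. x * y \<in> ideal_gen X \<Longrightarrow> y \<in> ideal_gen X"
    and p: "ktorsion_free n a {} (ideal_gen X) p"
    and Sp: "ktorsion_free n a {} (ideal_gen X) (Suc p)"
  shows "ktorsion_free n a {} (ideal_gen (insert x X)) (Suc p)"
  unfolding ktorsion_free_def
proof (intro ballI impI)
  let ?J = "ideal_gen X"
  note J = is_ideal_ideal_gen[of X]
  fix z assume z: "z \<in> kchain n (Suc p)" and cyc: "\<forall>T. kdiff n a z T \<in> ideal_gen (insert x X)"
  \<comment> \<open>\<open>w\<close> represents the image of the class of \<open>z\<close> under the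
    connecting map.\<close>
  obtain w where w: "w \<in> kchain n p" "\<And>T. kdiff n a z T - x * w T \<in> ?J"
    using kchain_quotient[OF kdiff_kchain[OF z]] cyc by metis
  have "kdiff n a w T \<in> ?J" for T
  proof (rule nzd)
    have "kdiff n a (\<lambda>T. kdiff n a z T - x * w T) T \<in> ?J" by (rule kdiff_in_ideal[OF J w(2)])
    then have "- (x * kdiff n a w T) \<in> ?J" unfolding kdiff_diff kdiff_scale kdiff_kdiff by simp
    from is_ideal_uminus[OF J this] show "x * kdiff n a w T \<in> ?J" by simp
  qed
  then obtain t where t: "t \<in> kchain n (Suc p)" "\<And>T. w T - kdiff n a t T \<in> ?J"
    using ktorsion_freeD[OF p w(1)] by blast
  \<comment> \<open>Subtracting \<open>x t\<close> does not change the class modulo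
    \<open>x\<close>, but turns \<open>z\<close> into a cycle modulo \<open>X\<close>.\<close>
  have "kdiff n a (\<lambda>T. z T - x * t T) T \<in> ?J" for T
    using is_ideal_add[OF J w(2)[of T] is_ideal_mult[OF J t(2)[of T], of x]]
    unfolding kdiff_diff kdiff_scale by (simp add: algebra_simps)
  then obtain u where u: "u \<in> kchain n (Suc (Suc p))" "\<And>T. (z T - x * t T) - kdiff n a u T \<in> ?J"
    using ktorsion_freeD[OF Sp kchain_diff[OF z kchain_scale[OF t(1)]]] by blast
  have "z T - kdiff n a u T \<in> ideal_gen (insert x X)" for T
    using u(2)[of T] by (intro ideal_gen_insertI[of _ _ "t T"]) (simp add: algebra_simps)
  with u(1) show "kboundary n a (ideal_gen (insert x X)) (Suc p) z" unfolding kboundary_def by blast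
qed

text \<open>Homology on \<open>ys\<close> starts out zero in all positive degrees, and each further
  quotient costs one degree of vanishing.\<close>

lemma koszul_homology_regular_quotient_zero:
  assumes "weakly_regular ys" "weakly_regular xs" "j \<le> length xs" "j < p"
  shows "ktorsion_free (length ys) ((!) ys) {} (ideal_gen (set (take j xs))) p"
  using assms(3,4)
proof (induction j arbitrary: p)
  case 0 then show ?case using koszul_acyclic[OF assms(1)] by (simp add: ideal_gen_empty)
next
  case (Suc j)
  then obtain q where q: "p = Suc q" "j < q" by (cases p) auto
  from Suc.prems have j: "j < length xs" by simp
  have "set (take (Suc j) xs) = insert (xs ! j) (set (take j xs))"
    using j by (simp add: take_Suc_conv_app_nth)
  moreover from weakly_regularD[OF assms(2) j] Suc.IH[of q] Suc.IH[of "Suc q"]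
  have "ktorsion_free (length ys) ((!) ys) {} (ideal_gen (insert (xs ! j) (set (take j xs)))) (Suc q)"
    by (rule koszul_homology_quotient_zero) (use q j in simp_all)
  ultimately show ?case using q by simp
qed

text \<open>An element killed by \<open>ys\<close> is the coefficient of a top-degree Koszul cycle
  on \<open>ys\<close> over \<open>A/(xs)\<close>. The homology there vanishes because
  \<open>xs\<close> is shorter, and the top degree has no nonzero boundaries.\<close>

lemma regular_quotient_torsion_free:
  assumes "weakly_regular ys" "weakly_regular xs" "length xs < length ys"
    and "\<And>y. y \<in> set ys \<Longrightarrow> y * u \<in> ideal_gen (set xs)"
  shows "u \<in> ideal_gen (set xs)"
proof -
  let ?n = "length ys" and ?J = "ideal_gen (set xs)"
  note J = is_ideal_ideal_gen[of "set xs"]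
  define z where "z T = (if T = {..<?n} then u else 0)" for T
  have "ktorsion_free ?n ((!) ys) {} ?J ?n"
    using koszul_homology_regular_quotient_zero[OF assms(1,2), of "length xs" ?n] assms(3) by simp
  moreover have "z \<in> kchain ?n ?n" by (auto simp: kchain_def z_def)
  moreover have "kdiff ?n ((!) ys) z T \<in> ?J" for T
    unfolding kdiff_def
  proof (rule is_ideal_sum[OF J])
    fix i assume "i \<in> {..<?n}"
    then have "ys ! i * z (insert i T) \<in> ?J"
      using assms(4)[of "ys ! i"] is_ideal_zero[OF J] by (simp add: z_def)
    then have "ksign i T * (ys ! i * z (insert i T)) \<in> ?J" by (rule is_ideal_mult[OF J])
    then show "(if i \<in> T then 0 else ksign i T * ys ! i * z (insert i T)) \<in> ?J"
      using is_ideal_zero[OF J] by (simp add: mult.assoc)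
  qed
  ultimately obtain v where v: "v \<in> kchain ?n (Suc ?n)" "\<And>T. z T - kdiff ?n ((!) ys) v T \<in> ?J"
    by (rule ktorsion_freeD) auto
  have "kdiff ?n ((!) ys) v {..<?n} = 0" by (simp add: kdiff_def kchain_above_eq_0[OF v(1)])
  with v(2)[of "{..<?n}"] show ?thesis by (simp add: z_def)
qed

section \<open>Koszul syzygies\<close>

lemma sum_fun_apply: "(\<Sum>i\<in>F. f i) x = (\<Sum>i\<in>F. f i x)"
  by (induction F rule: infinite_finite_induct) simp_all

lemma submod_genI:
  assumes "finite F" "F \<subseteq> S"
  shows "(\<lambda>k. \<Sum>v\<in>F. c v * v k) \<in> submod_gen S"
  using assms unfolding submod_gen_def by (fastforce simp: fun_eq_iff sum_fun_apply)

lemma submod_genE: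
  assumes "x \<in> submod_gen S"
  obtains F c where "finite F" "F \<subseteq> S" "x = (\<lambda>k. \<Sum>v\<in>F. c v * v k)"
  using assms unfolding submod_gen_def by (auto simp: fun_eq_iff sum_fun_apply)

lemma submod_gen_base: "v \<in> S \<Longrightarrow> v \<in> submod_gen S"
  using submod_genI[of "{v}" S "\<lambda>_. 1"] by simp

lemma submod_gen_zero: "(\<lambda>_. 0) \<in> submod_gen S"
  using submod_genI[of "{}" S "\<lambda>_. 0"] by simp

lemma submod_gen_add:
  assumes "x \<in> submod_gen S" "y \<in> submod_gen S"
  shows "(\<lambda>k. x k + y k) \<in> submod_gen S"
proof -
  obtain F c where F: "finite F" "F \<subseteq> S" "x = (\<lambda>k. \<Sum>v\<in>F. c v * v k)"
    using assms(1) by (rule submod_genE)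
  obtain H e where H: "finite H" "H \<subseteq> S" "y = (\<lambda>k. \<Sum>v\<in>H. e v * v k)"
    using assms(2) by (rule submod_genE)
  define c' where "c' v = (if v \<in> F then c v else 0)" for v
  define e' where "e' v = (if v \<in> H then e v else 0)" for v
  have "x k = (\<Sum>v\<in>F \<union> H. c' v * v k)" for k unfolding F(3)
    by (rule sum.mono_neutral_cong_left) (use F(1) H(1) in \<open>auto simp: c'_def\<close>)
  moreover have "y k = (\<Sum>v\<in>F \<union> H. e' v * v k)" for k unfolding H(3)
    by (rule sum.mono_neutral_cong_left) (use F(1) H(1) in \<open>auto simp: e'_def\<close>)
  ultimately have "(\<lambda>k. x k + y k) = (\<lambda>k. \<Sum>v\<in>F \<union> H. (c' v + e' v) * v k)"
    by (simp add: sum.distrib distrib_right)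
  then show ?thesis using submod_genI[of "F \<union> H" S "\<lambda>v. c' v + e' v"] F H by simp
qed

lemma submod_gen_scale:
  assumes "x \<in> submod_gen S"
  shows "(\<lambda>k. r * x k) \<in> submod_gen S"
proof -
  obtain F c where F: "finite F" "F \<subseteq> S" "x = (\<lambda>k. \<Sum>v\<in>F. c v * v k)"
    using assms by (rule submod_genE)
  then have "(\<lambda>k. r * x k) = (\<lambda>k. \<Sum>v\<in>F. (r * c v) * v k)"
    by (simp add: sum_distrib_left mult.assoc)
  then show ?thesis using submod_genI[of F S "\<lambda>v. r * c v"] F by simp
qed

lemma submod_gen_sum:
  assumes "\<And>i. i \<in> F \<Longrightarrow> f i \<in> submod_gen S"
  shows "(\<lambda>k. \<Sum>i\<in>F. f i k) \<in> submod_gen S"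
  using assms
  by (induction F rule: infinite_finite_induct) (auto simp: submod_gen_zero submod_gen_add)

text \<open>Elements of \<open>B_1\<close> are handled as vectors \<open>M a\<close> with
  \<open>M\<close> an alternating matrix, a form that is easier to exhibit and to compute with than
  a combination of generators.\<close>

definition alternating :: "(nat \<Rightarrow> nat \<Rightarrow> 'a::comm_ring_1) \<Rightarrow> bool" where
  "alternating M \<longleftrightarrow> (\<forall>i. M i i = 0) \<and> (\<forall>i j. M i j = - M j i)"

lemma alternatingD:
  assumes "alternating M"
  shows "M i i = 0" "M i j = - M j i"
  using assms unfolding alternating_def by blast+

lemma koszul_syzygiesI:
  assumes M: "alternating M" and x: "x \<in> freemod n" "\<And>k. k < n \<Longrightarrow> x k = (\<Sum>j<n. M k j * a j)"
  shows "x \<in> koszul_syzygies n a"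
proof -
  \<comment> \<open>Only the entries below the diagonal serve as coefficients, so that each
    unordered pair counts once; the entries above it reappear through the second term of
    \<open>koszul_syz\<close>.\<close>
  define y where "y k = (\<Sum>i<n. \<Sum>j<n. (if j < i then M i j else 0) * koszul_syz a i j k)" for k
  have "y \<in> koszul_syzygies n a" unfolding y_def koszul_syzygies_def
    by (intro submod_gen_sum submod_gen_scale submod_gen_base) blast
  moreover have "x = y"
  proof
    fix k show "x k = y k"
    proof (cases "k < n")
      case False
      then have "y k = 0" unfolding y_def by (intro sum.neutral ballI) (auto simp: koszul_syz_def)
      then show ?thesis using False x(1) by (simp add: freemod_def)
    next
      case True
      have "y k = (\<Sum>i<n. \<Sum>j<n. (if i = k then if j < k then M k j * a j else 0 else 0))
                - (\<Sum>i<n. \<Sum>j<n. (if j = k then if k < i then M i k * a i else 0 else 0))"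
        unfolding y_def sum_subtractf[symmetric]
        by (intro sum.cong refl) (auto simp: koszul_syz_def)
      also have "(\<Sum>i<n. \<Sum>j<n. (if i = k then if j < k then M k j * a j else 0 else 0))
          = (\<Sum>j<n. if j < k then M k j * a j else 0)"
        using True by (subst sum.swap) simp
      also have "(\<Sum>i<n. \<Sum>j<n. (if j = k then if k < i then M i k * a i else 0 else 0))
          = (\<Sum>j<n. if k < j then M j k * a j else 0)"
        using True by simp
      also have "(\<Sum>j<n. if j < k then M k j * a j else 0) - (\<Sum>j<n. if k < j then M j k * a j else 0)
          = (\<Sum>j<n. M k j * a j)"
        unfolding sum_subtractf[symmetric]
      proof (intro sum.cong refl)
        fix j
        consider "j < k" | "j = k" | "k < j" by linarith
        then show "(if j < k then M k j * a j else 0) - (if k < j then M j k * a j else 0) = M k j * a j"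
          using alternatingD(1)[OF M, of k] alternatingD(2)[OF M, of k j] by cases simp_all
      qed
      finally show ?thesis using x(2)[OF True] by simp
    qed
  qed
  ultimately show ?thesis by simp
qed

lemma koszul_syzygiesE:
  fixes a :: "nat \<Rightarrow> 'a::comm_ring_1"
  assumes "x \<in> koszul_syzygies n a"
  obtains M where "alternating M" "x \<in> freemod n" "\<And>k. k < n \<Longrightarrow> x k = (\<Sum>j<n. M k j * a j)"
proof -
  let ?P = "\<lambda>x M. alternating M \<and> x \<in> freemod n \<and> (\<forall>k<n. x k = (\<Sum>j<n. M k j * a j))"
  obtain F c where F: "finite F" "F \<subseteq> {koszul_syz a i j | i j. i < n \<and> j < n}"
    "x = (\<lambda>k. \<Sum>v\<in>F. c v * v k)"
    using assms unfolding koszul_syzygies_def by (rule submod_genE)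
  have "\<exists>M. ?P v M" if v: "v \<in> F" for v
  proof -
    obtain i j where ij: "i < n" "j < n" "v = koszul_syz a i j" using F(2) v by blast
    \<comment> \<open>The elementary alternating matrix of the pair \<open>(i, j)\<close>; for
      \<open>i = j\<close> it is zero, as is the generator.\<close>
    define M :: "nat \<Rightarrow> nat \<Rightarrow> 'a" where
      "M k l = (if l = j then if k = i then 1 else 0 else 0) - (if l = i then if k = j then 1 else 0 else 0)" for k l
    have "alternating M" by (auto simp: alternating_def M_def)
    moreover have "v \<in> freemod n" using ij by (auto simp: freemod_def koszul_syz_def)
    moreover have "v k = (\<Sum>l<n. M k l * a l)" for k
      using ij by (simp add: M_def koszul_syz_def left_diff_distrib sum_subtractf
          if_distrib[of "\<lambda>c. c * _"] cong: if_cong)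
    ultimately show ?thesis by blast
  qed
  then obtain M where M: "\<And>v. v \<in> F \<Longrightarrow> ?P v (M v)" by metis
  show thesis
  proof (rule that[of "\<lambda>k l. \<Sum>v\<in>F. c v * M v k l"])
    show "alternating (\<lambda>k l. \<Sum>v\<in>F. c v * M v k l)" unfolding alternating_def
    proof (intro conjI allI)
      show "(\<Sum>v\<in>F. c v * M v i i) = 0" for i
        using M by (intro sum.neutral) (simp add: alternatingD(1))
      show "(\<Sum>v\<in>F. c v * M v i j) = - (\<Sum>v\<in>F. c v * M v j i)" for i j
        unfolding sum_negf[symmetric] using M
        by (intro sum.cong refl) (metis alternatingD(2) mult_minus_right)
    qed
    show "x \<in> freemod n" unfolding F(3) freemod_def
    proof (intro CollectI allI impI sum.neutral ballI)
      fix i v assume "n \<le> i" "v \<in> F"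
      then have "v i = 0" using M[of v] by (simp add: freemod_def)
      then show "c v * v i = 0" by simp
    qed
    fix k assume k: "k < n"
    have "c v * v k = (\<Sum>j<n. c v * M v k j * a j)" if "v \<in> F" for v
    proof -
      have "v k = (\<Sum>j<n. M v k j * a j)" using M[OF that] k by blast
      then show ?thesis by (metis (no_types, lifting) mult.assoc sum.cong sum_distrib_left)
    qed
    then have "x k = (\<Sum>v\<in>F. \<Sum>j<n. c v * M v k j * a j)" unfolding F(3) by (rule sum.cong[OF refl])
    also have "\<dots> = (\<Sum>j<n. (\<Sum>v\<in>F. c v * M v k j) * a j)"
      by (subst sum.swap) (simp add: sum_distrib_right)
    finally show "x k = (\<Sum>j<n. (\<Sum>v\<in>F. c v * M v k j) * a j)" .
  qed
qed

text \<open>For \<open>x = M a\<close>, pairing \<open>x\<close> with \<open>a\<close> gives the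
  double sum of \<open>M i j * a j * a i\<close>, which is alternating.\<close>

lemma koszul_syzygies_subset:
  "koszul_syzygies n a \<subseteq> syzygies n a \<inter> ideal_freemod (ideal_gen (a ` {..<n})) n"
proof
  fix x assume "x \<in> koszul_syzygies n a"
  then obtain M where M: "alternating M" "x \<in> freemod n" "\<And>k. k < n \<Longrightarrow> x k = (\<Sum>j<n. M k j * a j)"
    by (rule koszul_syzygiesE) blast
  have "x k \<in> ideal_gen (a ` {..<n})" if "k < n" for k
    unfolding M(3)[OF that]
    by (intro is_ideal_sum is_ideal_mult is_ideal_ideal_gen ideal_gen_base) auto
  moreover have "(\<Sum>i<n. x i * a i) = (\<Sum>i<n. \<Sum>j<n. M i j * a j * a i)"
    by (intro sum.cong refl) (simp add: M(3) sum_distrib_right)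
  moreover have "(\<Sum>i<n. \<Sum>j<n. M i j * a j * a i) = 0"
  proof (rule alternating_double_sum)
    show "M i i * a i * a i = 0" for i by (simp add: alternatingD(1)[OF M(1)])
    show "M i j * a j * a i = - (M j i * a i * a j)" for i j
    proof -
      have "M i j = - M j i" using M(1) by (rule alternatingD)
      then show ?thesis by (simp add: mult_ac)
    qed
  qed
  ultimately show "x \<in> syzygies n a \<inter> ideal_freemod (ideal_gen (a ` {..<n})) n"
    using M(2) by (simp add: syzygies_def ideal_freemod_def)
qed

section \<open>Vectors as Koszul chains of degree one, and torsion in first Koszul homology\<close>

definition vec_chain :: "nat \<Rightarrow> (nat \<Rightarrow> 'a::comm_ring_1) \<Rightarrow> nat set \<Rightarrow> 'a" where
  "vec_chain n x T = (if \<exists>i<n. T = {i} then x (the_elem T) else 0)"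

lemma vec_chain_singleton: "i < n \<Longrightarrow> vec_chain n x {i} = x i"
  by (simp add: vec_chain_def)

lemma vec_chain_kchain: "vec_chain n x \<in> kchain n 1"
  by (auto simp: kchain_def vec_chain_def split: if_splits)

lemma kdiff_vec_chain:
  assumes "x \<in> syzygies n a"
  shows "kdiff n a (vec_chain n x) T = 0"
proof (cases "T = {}")
  case True
  have "kdiff n a (vec_chain n x) T = (\<Sum>i<n. x i * a i)"
    unfolding kdiff_def True by (intro sum.cong refl) (simp add: ksign_def vec_chain_singleton mult.commute)
  then show ?thesis using assms by (simp add: syzygies_def)
next
  case False
  then have "vec_chain n x (insert i T) = 0" if "i \<notin> T" for i
    using that by (auto simp: vec_chain_def)
  then show ?thesis unfolding kdiff_def by (intro sum.neutral) auto
qed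

lemma ksign_singleton: "ksign i {k} = (if k < i then - 1 else 1)"
proof -
  have "{t \<in> {k}. t < i} = (if k < i then {k} else {})" by auto
  then show ?thesis by (simp add: ksign_def)
qed

text \<open>A chain of degree two is an alternating matrix recorded on two-element sets, and its
  differential is the matrix applied to \<open>a\<close>.\<close>

lemma koszul_syzygies_iff_kboundary:
  fixes a :: "nat \<Rightarrow> 'a::comm_ring_1"
  assumes "x \<in> freemod n"
  shows "x \<in> koszul_syzygies n a \<longleftrightarrow> kboundary n a {0} 1 (vec_chain n x)"
proof
  assume "x \<in> koszul_syzygies n a"
  then obtain M where M: "alternating M" "\<And>k. k < n \<Longrightarrow> x k = (\<Sum>j<n. M k j * a j)"
    by (rule koszul_syzygiesE) blast
  \<comment> \<open>The order \<open>Max\<close>, \<open>Min\<close> fixes the sign: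
    \<open>ksign i {k}\<close> is 1 for \<open>i < k\<close> and -1 for \<open>i > k\<close>, so
    \<open>a i\<close> gets the coefficient \<open>M k i\<close> in both cases.\<close>
  define u where "u T = (if T \<subseteq> {..<n} \<and> card T = 2 then M (Max T) (Min T) else 0)" for T
  have u: "u \<in> kchain n 2" by (auto simp: kchain_def u_def)
  then have du: "kdiff n a u \<in> kchain n 1" by (intro kdiff_kchain) (simp add: numeral_2_eq_2)
  have "vec_chain n x T = kdiff n a u T" for T
  proof (cases "\<exists>k<n. T = {k}")
    case True
    then obtain k where k: "k < n" "T = {k}" by blast
    have "M k i * a i = (if i \<in> T then 0 else ksign i T * a i * u (insert i T))" if "i < n" for i
    proof -
      have "M k i = - M i k" "M k k = 0" using alternatingD[OF M(1)] by blast+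
      then show ?thesis using k that
        by (cases i k rule: linorder_cases) (auto simp: u_def ksign_singleton max_def min_def)
    qed
    then have "(\<Sum>i<n. M k i * a i) = kdiff n a u T" unfolding kdiff_def by (intro sum.cong) auto
    then show ?thesis using k by (simp add: vec_chain_singleton M(2))
  next
    case False
    then have "kdiff n a u T = 0" using du unfolding kchain_def by (auto simp: card_1_singleton_iff)
    with False show ?thesis by (auto simp: vec_chain_def)
  qed
  with u show "kboundary n a {0} 1 (vec_chain n x)"
    unfolding kboundary_def by (intro bexI[of _ u]) (simp_all add: numeral_2_eq_2)
next
  assume "kboundary n a {0} 1 (vec_chain n x)"
  then obtain u where u: "\<And>T. vec_chain n x T = kdiff n a u T" unfolding kboundary_def by auto
  \<comment> \<open>The diagonal is set to 0 explicitly, since \<open>{i, k}\<close> is a singleton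
    there; elsewhere the factor \<open>ksign i {k}\<close> supplies the antisymmetry.\<close>
  define M where "M k i = (if i = k then 0 else ksign i {k} * u {i, k})" for k i
  show "x \<in> koszul_syzygies n a"
  proof (rule koszul_syzygiesI[OF _ assms, of M])
    show "alternating M"
      by (auto simp: alternating_def M_def ksign_singleton insert_commute)
    fix k assume "k < n"
    then have "x k = kdiff n a u {k}" using u[of "{k}"] by (simp add: vec_chain_singleton)
    also have "\<dots> = (\<Sum>j<n. M k j * a j)" unfolding kdiff_def
      by (intro sum.cong refl) (simp add: M_def mult_ac)
    finally show "x k = (\<Sum>j<n. M k j * a j)" .
  qed
qed

text \<open>In degree \<open>n\<close> all boundaries are zero, so annihilation and vanishing of a
  class are tested coefficient by coefficient modulo \<open>J\<close>.\<close>

lemma ktorsion_free_top: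
  fixes a :: "nat \<Rightarrow> 'a::comm_ring_1"
  assumes J: "is_ideal J" and tf: "\<And>u. (\<And>s. s \<in> S \<Longrightarrow> s * u \<in> J) \<Longrightarrow> u \<in> J"
  shows "ktorsion_free n a S J n"
  unfolding ktorsion_free_def
proof (intro ballI impI)
  fix z :: "nat set \<Rightarrow> 'a"
  assume ann: "\<forall>s\<in>S. kboundary n a J n (\<lambda>T. s * z T)"
  have zero: "kdiff n a u T = 0" if "u \<in> kchain n (Suc n)" for u T
    using kchain_above_eq_0[OF that] by (auto simp: kdiff_def intro!: sum.neutral)
  have "s * z T \<in> J" if s: "s \<in> S" for s T
  proof -
    obtain u where u: "u \<in> kchain n (Suc n)" "\<And>T. s * z T - kdiff n a u T \<in> J"
      using ann s unfolding kboundary_def by blast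
    from u(2)[of T] show ?thesis by (simp add: zero[OF u(1)])
  qed
  then have "z T \<in> J" for T by (rule tf)
  moreover have "(\<lambda>_. 0) \<in> kchain n (Suc n)" by (simp add: kchain_def)
  ultimately show "kboundary n a J n z"
    unfolding kboundary_def by (intro bexI[of _ "\<lambda>_. 0"]) (simp_all add: zero)
qed

text \<open>Descent along the \<open>n - 1\<close> members of \<open>xs\<close> leads from degree
  \<open>n\<close> over \<open>A/(xs)\<close> exactly to degree 1 over \<open>A\<close>, carrying
  torsion-freeness of \<open>A/(xs)\<close> over to \<open>Z_1/B_1\<close>.\<close>

lemma koszul_syzygies_torsion_free:
  assumes xs: "weakly_regular xs" "set xs \<subseteq> ideal_gen (a ` {..<n})" "n = Suc (length xs)"
    and tf: "\<And>u. (\<And>s. s \<in> S \<Longrightarrow> s * u \<in> ideal_gen (set xs)) \<Longrightarrow> u \<in> ideal_gen (set xs)"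
    and z: "z \<in> syzygies n a" "\<And>s. s \<in> S \<Longrightarrow> (\<lambda>k. s * z k) \<in> koszul_syzygies n a"
  shows "z \<in> koszul_syzygies n a"
proof -
  have free: "z \<in> freemod n" using z(1) by (simp add: syzygies_def)
  have "ktorsion_free n a S (ideal_gen (set xs)) n"
    by (rule ktorsion_free_top[OF is_ideal_ideal_gen tf])
  then have "ktorsion_free n a S {0} 1"
    using ktorsion_free_descend_list[OF xs(1,2), of S 1] xs(3) by simp
  moreover have "kboundary n a {0} 1 (\<lambda>T. s * vec_chain n z T)" if "s \<in> S" for s
  proof -
    have "(\<lambda>T. s * vec_chain n z T) = vec_chain n (\<lambda>k. s * z k)"
      by (auto simp: vec_chain_def fun_eq_iff)
    moreover have "(\<lambda>k. s * z k) \<in> freemod n" using free by (simp add: freemod_def)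
    ultimately show ?thesis using z(2)[OF that] koszul_syzygies_iff_kboundary by metis
  qed
  ultimately have "kboundary n a {0} 1 (vec_chain n z)"
    using vec_chain_kchain kdiff_vec_chain[OF z(1)] unfolding ktorsion_free_def by blast
  then show ?thesis using koszul_syzygies_iff_kboundary[OF free] by blast
qed

text \<open>Annihilation by a power of \<open>m\<close> is reduced to annihilation by
  \<open>m\<close>: for \<open>y\<close> in the \<open>k\<close>-th power and
  \<open>s \<in> m\<close>, the product \<open>s * y\<close> lies in the next power, so
  \<open>m\<close> kills the class of \<open>y z\<close>.\<close>

lemma koszul_syzygies_saturated:
  assumes tf: "\<And>z. z \<in> syzygies n a \<Longrightarrow> (\<And>s. s \<in> m \<Longrightarrow> (\<lambda>k. s * z k) \<in> koszul_syzygies n a) \<Longrightarrow>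
      z \<in> koszul_syzygies n a"
    and z: "z \<in> syzygies n a" "\<And>y. y \<in> ideal_pow m k \<Longrightarrow> (\<lambda>i. y * z i) \<in> koszul_syzygies n a"
  shows "z \<in> koszul_syzygies n a"
  using z
proof (induction k arbitrary: z)
  case 0
  from 0(2)[of 1] show ?case by simp
next
  case (Suc k)
  show ?case
  proof (rule Suc.IH[OF Suc.prems(1)])
    fix y assume y: "y \<in> ideal_pow m k"
    show "(\<lambda>i. y * z i) \<in> koszul_syzygies n a"
    proof (rule tf)
      have "(\<Sum>i<n. y * z i * a i) = y * (\<Sum>i<n. z i * a i)" by (simp add: sum_distrib_left mult.assoc)
      then show "(\<lambda>i. y * z i) \<in> syzygies n a" using Suc.prems(1) by (simp add: syzygies_def freemod_def)
      fix s assume "s \<in> m"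
      with y have "s * y \<in> ideal_pow m (Suc k)"
        unfolding ideal_pow.simps ideal_mult_def by (blast intro: ideal_gen_base)
      from Suc.prems(2)[OF this] show "(\<lambda>i. s * (y * z i)) \<in> koszul_syzygies n a"
        by (simp add: mult.assoc)
    qed
  qed
qed

section \<open>The symmetric square\<close>

text \<open>The additive extension of \<open>\<phi>\<close> to the free abelian group on pairs; it
  is additive on finitely supported functions only.\<close>

definition formal_eval :: "('a \<times> 'a \<Rightarrow> 'b::comm_ring_1) \<Rightarrow> ('a \<times> 'a \<Rightarrow> int) \<Rightarrow> 'b" where
  "formal_eval \<phi> f = (\<Sum>p\<in>{p. f p \<noteq> 0}. of_int (f p) * \<phi> p)"

lemma formal_eval_superset:
  assumes "finite F" "{p. f p \<noteq> 0} \<subseteq> F"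
  shows "formal_eval \<phi> f = (\<Sum>p\<in>F. of_int (f p) * \<phi> p)"
  unfolding formal_eval_def by (rule sum.mono_neutral_left) (use assms in auto)

lemma finite_support_add:
  fixes f g :: "'b \<Rightarrow> int"
  shows "finite {p. f p \<noteq> 0} \<Longrightarrow> finite {p. g p \<noteq> 0} \<Longrightarrow> finite {p. (f + g) p \<noteq> 0}"
  by (rule finite_subset[of _ "{p. f p \<noteq> 0} \<union> {p. g p \<noteq> 0}"]) auto

lemma finite_support_diff:
  fixes f g :: "'b \<Rightarrow> int"
  shows "finite {p. f p \<noteq> 0} \<Longrightarrow> finite {p. g p \<noteq> 0} \<Longrightarrow> finite {p. (f - g) p \<noteq> 0}"
  by (rule finite_subset[of _ "{p. f p \<noteq> 0} \<union> {p. g p \<noteq> 0}"]) auto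

lemma finite_support_fsym: "finite {q. fsym p q \<noteq> 0}"
  by (simp add: fsym_def)

lemma finite_support_sum:
  fixes f :: "'i \<Rightarrow> 'b \<Rightarrow> int"
  assumes "\<And>i. i \<in> F \<Longrightarrow> finite {p. f i p \<noteq> 0}"
  shows "finite {p. (\<Sum>i\<in>F. f i) p \<noteq> 0}"
  using assms
proof (induction F rule: infinite_finite_induct)
  case (insert i F)
  then show ?case using finite_support_add[of "f i" "\<Sum>i\<in>F. f i"] by simp
qed simp_all

lemma finite_support_sym2_rel: "f \<in> sym2_rel I \<Longrightarrow> finite {p. f p \<noteq> 0}"
proof (induction rule: sym2_rel.induct)
  case (neg u) then show ?case by simp
next
  case (add u v) then show ?case by (intro finite_support_add)
qed (simp, (intro finite_support_diff finite_support_fsym)+)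

lemma formal_eval_zero: "formal_eval \<phi> (\<lambda>_. 0) = 0"
  by (simp add: formal_eval_def)

lemma formal_eval_fsym: "formal_eval \<phi> (fsym p) = \<phi> p"
  by (simp add: formal_eval_superset[of "{p}"] fsym_def)

lemma formal_eval_uminus: "formal_eval \<phi> (- f) = - formal_eval \<phi> f"
  by (simp add: formal_eval_def sum_negf)

lemma formal_eval_add:
  assumes "finite {p. f p \<noteq> 0}" "finite {p. g p \<noteq> 0}"
  shows "formal_eval \<phi> (f + g) = formal_eval \<phi> f + formal_eval \<phi> g"
proof -
  let ?F = "{p. f p \<noteq> 0} \<union> {p. g p \<noteq> 0}"
  have "formal_eval \<phi> h = (\<Sum>p\<in>?F. of_int (h p) * \<phi> p)" if "h \<in> {f, g, f + g}" for h
    by (rule formal_eval_superset) (use assms that in auto)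
  then show ?thesis by (simp add: sum.distrib distrib_right)
qed

lemma formal_eval_diff:
  assumes "finite {p. f p \<noteq> 0}" "finite {p. g p \<noteq> 0}"
  shows "formal_eval \<phi> (f - g) = formal_eval \<phi> f - formal_eval \<phi> g"
  using formal_eval_add[of f "- g" \<phi>] assms by (simp add: formal_eval_uminus)

lemma formal_eval_sum:
  assumes "finite F" "\<And>i. i \<in> F \<Longrightarrow> finite {p. f i p \<noteq> 0}"
  shows "formal_eval \<phi> (\<Sum>i\<in>F. f i) = (\<Sum>i\<in>F. formal_eval \<phi> (f i))"
  using assms
proof (induction F)
  case empty then show ?case by (simp add: formal_eval_def)
next
  case (insert i F)
  then have "finite {p. (\<Sum>i\<in>F. f i) p \<noteq> 0}" by (intro finite_support_sum) simp
  then have "formal_eval \<phi> (f i + (\<Sum>i\<in>F. f i)) = formal_eval \<phi> (f i) + formal_eval \<phi> (\<Sum>i\<in>F. f i)"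
    using insert.prems by (intro formal_eval_add) simp_all
  with insert show ?case by (simp add: sum.insert[OF insert.hyps(1,2)] del: plus_fun_apply)
qed

lemma formal_eval_fsym_diff: "formal_eval \<phi> (fsym p - fsym q) = \<phi> p - \<phi> q"
  by (simp add: formal_eval_diff finite_support_fsym formal_eval_fsym)

lemma formal_eval_fsym_diff2: "formal_eval \<phi> (fsym p - fsym q - fsym r) = \<phi> p - \<phi> q - \<phi> r"
  using finite_support_diff[OF finite_support_fsym finite_support_fsym, of p q]
  by (simp only: formal_eval_diff[OF _ finite_support_fsym] formal_eval_fsym_diff formal_eval_fsym)

text \<open>The rules of the inductive set \<open>sym2_rel\<close> contain \<open>\<eta>\<close>-expanded sums of functions, which the
  pointwise simplification rules would turn into sums of values.\<close>
declare plus_fun_apply [simp del] minus_apply [simp del] uminus_apply [simp del]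

text \<open>Well-definedness of the multiplication map on \<open>Sym^2\<close>.\<close>

lemma formal_eval_mult_sym2_rel:
  "f \<in> sym2_rel I \<Longrightarrow> formal_eval (\<lambda>p. fst p * snd p) f = 0"
proof (induction rule: sym2_rel.induct)
  case (add u v)
  then show ?case
    by (simp only: formal_eval_add[OF finite_support_sym2_rel[of u I] finite_support_sym2_rel[of v I]]) simp
qed (simp_all only: formal_eval_zero formal_eval_uminus formal_eval_fsym_diff formal_eval_fsym_diff2,
    simp_all add: algebra_simps)

section \<open>From the symmetric square to Koszul syzygies\<close>

lemma syzygetic_iff:
  "syzygetic I \<longleftrightarrow> (\<forall>f. finite {p. f p \<noteq> 0} \<longrightarrow> {p. f p \<noteq> 0} \<subseteq> I \<times> I \<longrightarrow>
     formal_eval (\<lambda>p. fst p * snd p) f = 0 \<longrightarrow> f \<in> sym2_rel I)"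
  unfolding syzygetic_def formal_eval_def by (auto simp: mult.assoc)

text \<open>With \<open>y = \<Sum> q_i a_i\<close>, the alternating matrix
  \<open>s k * q j - s j * q k\<close> sends \<open>a\<close> to \<open>s y\<close>, because
  \<open>\<Sum> s_j a_j = 0\<close>.\<close>

lemma ideal_times_syzygy_koszul:
  fixes a :: "nat \<Rightarrow> 'a::comm_ring_1"
  assumes "s \<in> syzygies n a" "y \<in> ideal_gen (a ` {..<n})"
  shows "(\<lambda>k. s k * y) \<in> koszul_syzygies n a"
proof -
  obtain q where q: "y = (\<Sum>i<n. q i * a i)" using assms(2) by (rule ideal_gen_imageE)
  show ?thesis
  proof (rule koszul_syzygiesI)
    show "alternating (\<lambda>k j. s k * q j - s j * q k)" by (simp add: alternating_def mult.commute)
    show "(\<lambda>k. s k * y) \<in> freemod n" using assms(1) by (simp add: syzygies_def freemod_def)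
    fix k
    have "(\<Sum>j<n. (s k * q j - s j * q k) * a j) = s k * y - q k * (\<Sum>j<n. s j * a j)"
      unfolding q sum_distrib_left sum_subtractf[symmetric] by (simp add: algebra_simps)
    then show "s k * y = (\<Sum>j<n. (s k * q j - s j * q k) * a j)"
      using assms(1) by (simp add: syzygies_def)
  qed
qed

text \<open>The map \<open>Sym\<^sup>2(I) \<rightarrow> A\<^sup>n/B\<^sub>1\<close> sending \<open>x y\<close> to the class of \<open>r(x) y\<close>, where \<open>r(x)\<close> is
  any coefficient vector with \<open>x = \<Sum> r(x)\<^sub>i a\<^sub>i\<close>; it is well defined because \<open>I Z\<^sub>1 \<subseteq> B\<^sub>1\<close>.\<close>
lemma sym2_rel_koszul:
  fixes a :: "nat \<Rightarrow> 'a::comm_ring_1" and n :: nat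
  defines "I \<equiv> ideal_gen (a ` {..<n})"
  assumes r: "\<And>x. x \<in> I \<Longrightarrow> r x \<in> freemod n \<and> x = (\<Sum>i<n. r x i * a i)"
    and f: "f \<in> sym2_rel I"
  shows "(\<lambda>k. formal_eval (\<lambda>p. r (fst p) k * snd p) f) \<in> koszul_syzygies n a"
proof -
  note I = is_ideal_ideal_gen[of "a ` {..<n}", folded I_def]
  \<comment> \<open>Changing the coefficient vector of \<open>x\<close> alters \<open>r(x) y\<close>
    by a syzygy times an element of \<open>I\<close>, so any convenient vector may stand in for
    \<open>r x\<close>.\<close>
  have rd: "(\<lambda>k. (r x k - s k) * y) \<in> koszul_syzygies n a"
    if "x \<in> I" "y \<in> I" "s \<in> freemod n" "x = (\<Sum>i<n. s i * a i)" for x y s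
  proof (rule ideal_times_syzygy_koszul)
    show "(\<lambda>k. r x k - s k) \<in> syzygies n a"
      using r[OF that(1)] that(3,4) by (simp add: syzygies_def freemod_def algebra_simps sum_subtractf)
  qed (use that in \<open>simp add: I_def\<close>)
  have radd: "(\<lambda>k. (r (x + x') k - (r x k + r x' k)) * y) \<in> koszul_syzygies n a"
    if "x \<in> I" "x' \<in> I" "y \<in> I" for x x' y
  proof (rule rd)
    have "x = (\<Sum>i<n. r x i * a i)" "x' = (\<Sum>i<n. r x' i * a i)" using r that by blast+
    then show "x + x' = (\<Sum>i<n. (r x i + r x' i) * a i)" by (simp add: distrib_right sum.distrib)
    show "(\<lambda>k. r x k + r x' k) \<in> freemod n" using r[of x] r[of x'] that by (simp add: freemod_def)
  qed (use that is_ideal_add[OF I] in auto)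
  have rscale: "(\<lambda>k. (r (c * x) k - c * r x k) * y) \<in> koszul_syzygies n a"
    if "x \<in> I" "y \<in> I" for c x y
  proof (rule rd)
    have "x = (\<Sum>i<n. r x i * a i)" using r that by blast
    then have "c * x = c * (\<Sum>i<n. r x i * a i)" by simp
    then show "c * x = (\<Sum>i<n. c * r x i * a i)" by (simp add: sum_distrib_left mult.assoc)
    show "(\<lambda>k. c * r x k) \<in> freemod n" using r[of x] that by (simp add: freemod_def)
  qed (use that is_ideal_mult[OF I] in auto)
  \<comment> \<open>The symmetry relation goes to the alternating matrix
    \<open>r(x) r(y)^T - r(y) r(x)^T\<close> applied to \<open>a\<close>.\<close>
  have rsym: "(\<lambda>k. r x k * y - r y k * x) \<in> koszul_syzygies n a" if "x \<in> I" "y \<in> I" for x y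
  proof (rule koszul_syzygiesI)
    show "alternating (\<lambda>k j. r x k * r y j - r y k * r x j)" by (simp add: alternating_def mult.commute)
    show "(\<lambda>k. r x k * y - r y k * x) \<in> freemod n" using r[of x] r[of y] that by (simp add: freemod_def)
    fix k
    have "(\<Sum>j<n. (r x k * r y j - r y k * r x j) * a j)
        = r x k * (\<Sum>j<n. r y j * a j) - r y k * (\<Sum>j<n. r x j * a j)"
      unfolding sum_distrib_left sum_subtractf[symmetric] by (simp add: algebra_simps)
    also have "\<dots> = r x k * y - r y k * x" using r that by metis
    finally show "r x k * y - r y k * x = (\<Sum>j<n. (r x k * r y j - r y k * r x j) * a j)" by simp
  qed
  show ?thesis using f
  proof (induction rule: sym2_rel.induct)
    case zero
    show ?case by (simp add: formal_eval_zero koszul_syzygies_def submod_gen_zero)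
  next
    case (add u v)
    have "formal_eval \<phi> (u + v) = formal_eval \<phi> u + formal_eval \<phi> v" for \<phi> :: "'a \<times> 'a \<Rightarrow> 'a"
      by (intro formal_eval_add finite_support_sym2_rel[of _ I] add.hyps)
    with add.IH show ?case by (simp add: koszul_syzygies_def submod_gen_add)
  next
    case (neg u)
    then show ?case unfolding koszul_syzygies_def formal_eval_uminus
      using submod_gen_scale[where r = "-1"] by fastforce
  next
    case (addl x x' y)
    from radd[OF this] show ?case unfolding formal_eval_fsym_diff2 by (simp add: algebra_simps)
  next
    case (addr x y y')
    show ?case unfolding formal_eval_fsym_diff2
      by (simp add: algebra_simps koszul_syzygies_def submod_gen_zero)
  next
    case (scal x y c)
    from rscale[OF this, of c] show ?case unfolding formal_eval_fsym_diff by (simp add: algebra_simps)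
  next
    case (symm x y)
    from rsym[OF this] show ?case by (simp add: formal_eval_fsym_diff)
  qed
qed

text \<open>The formal sum of the pairs \<open>(a i, x i)\<close> multiplies out to 0, so it is a
  relation; its image in \<open>A^n/B_1\<close> is therefore zero, and that image is the class of
  \<open>x\<close>.\<close>

lemma syzygetic_imp_koszul:
  fixes a :: "nat \<Rightarrow> 'a::comm_ring_1" and n :: nat
  defines "I \<equiv> ideal_gen (a ` {..<n})"
  assumes syz: "syzygetic I" and x: "x \<in> syzygies n a" "x \<in> ideal_freemod I n"
  shows "x \<in> koszul_syzygies n a"
proof -
  have aI: "a i \<in> I" if "i < n" for i unfolding I_def using that by (intro ideal_gen_base) auto
  have xI: "x i \<in> I" if "i < n" for i using x(2) that by (simp add: ideal_freemod_def)
  have xfree: "x \<in> freemod n" using x(1) by (simp add: syzygies_def)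
  have "\<exists>r. r \<in> freemod n \<and> y = (\<Sum>i<n. r i * a i)" if y: "y \<in> I" for y
  proof -
    obtain r where "y = (\<Sum>i<n. r i * a i)" using y unfolding I_def by (rule ideal_gen_imageE)
    then show ?thesis by (intro exI[of _ "\<lambda>i. if i < n then r i else 0"]) (simp add: freemod_def)
  qed
  then obtain r where r: "\<And>y. y \<in> I \<Longrightarrow> r y \<in> freemod n \<and> y = (\<Sum>i<n. r y i * a i)" by metis
  define f where "f = (\<Sum>i<n. fsym (a i, x i))"
  have eval: "formal_eval \<phi> f = (\<Sum>i<n. \<phi> (a i, x i))" for \<phi> :: "'a \<times> 'a \<Rightarrow> 'a"
    unfolding f_def by (simp add: formal_eval_sum finite_support_fsym formal_eval_fsym)
  have "f p = 0" if "p \<notin> I \<times> I" for p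
    unfolding f_def sum_fun_apply using that aI xI by (intro sum.neutral) (auto simp: fsym_def)
  then have "{p. f p \<noteq> 0} \<subseteq> I \<times> I" by blast
  moreover have "finite {p. f p \<noteq> 0}" unfolding f_def by (intro finite_support_sum finite_support_fsym)
  moreover have "formal_eval (\<lambda>p. fst p * snd p) f = 0"
    using x(1) by (simp add: eval syzygies_def mult.commute)
  ultimately have "f \<in> sym2_rel I" using syz unfolding syzygetic_iff by blast
  then have "(\<lambda>k. formal_eval (\<lambda>p. r (fst p) k * snd p) f) \<in> koszul_syzygies n a"
    using r unfolding I_def by (intro sym2_rel_koszul)
  then have 1: "(\<lambda>k. \<Sum>i<n. r (a i) k * x i) \<in> koszul_syzygies n a" by (simp add: eval)
  \<comment> \<open>The chosen vector \<open>r (a i)\<close> may differ from the unit vector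
    \<open>e i\<close>, but the difference is a syzygy, and multiplied by \<open>x i \<in> I\<close>
    it becomes Koszul.\<close>
  define e :: "nat \<Rightarrow> nat \<Rightarrow> 'a" where "e i k = (if i = k then 1 else 0)" for i k
  have "(\<lambda>k. (e i k - r (a i) k) * x i) \<in> koszul_syzygies n a" if i: "i < n" for i
  proof (rule ideal_times_syzygy_koszul)
    have "a i = (\<Sum>k<n. e i k * a k)"
      using i by (simp add: e_def if_distrib[of "\<lambda>c. c * _"] cong: if_cong)
    moreover have "a i = (\<Sum>k<n. r (a i) k * a k)" "r (a i) \<in> freemod n" using r[OF aI[OF i]] by auto
    ultimately have "(\<Sum>k<n. (e i k - r (a i) k) * a k) = 0"
      unfolding left_diff_distrib sum_subtractf by simp
    then show "(\<lambda>k. e i k - r (a i) k) \<in> syzygies n a"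
      using \<open>r (a i) \<in> freemod n\<close> i by (simp add: syzygies_def freemod_def e_def)
    show "x i \<in> ideal_gen (a ` {..<n})" using xI[OF i] by (simp add: I_def)
  qed
  then have 2: "(\<lambda>k. \<Sum>i<n. (e i k - r (a i) k) * x i) \<in> koszul_syzygies n a"
    unfolding koszul_syzygies_def by (intro submod_gen_sum) auto
  have "x = (\<lambda>k. (\<Sum>i<n. r (a i) k * x i) + (\<Sum>i<n. (e i k - r (a i) k) * x i))"
  proof
    fix k
    have "(\<Sum>i<n. r (a i) k * x i) + (\<Sum>i<n. (e i k - r (a i) k) * x i) = (\<Sum>i<n. e i k * x i)"
      unfolding sum.distrib[symmetric] by (simp add: algebra_simps)
    also have "\<dots> = x k"
      using xfree by (simp add: e_def freemod_def if_distrib[of "\<lambda>c. c * _"] cong: if_cong)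
    finally show "x k = (\<Sum>i<n. r (a i) k * x i) + (\<Sum>i<n. (e i k - r (a i) k) * x i)" by simp
  qed
  then show ?thesis using submod_gen_add[OF 1[unfolded koszul_syzygies_def] 2[unfolded koszul_syzygies_def]]
    unfolding koszul_syzygies_def by metis
qed

section \<open>Calculus of relations in the symmetric square\<close>

lemma sym2_rel_zero: "0 \<in> sym2_rel I"
  using sym2_rel.zero by (simp add: zero_fun_def)

lemma sym2_rel_diff: "u \<in> sym2_rel I \<Longrightarrow> v \<in> sym2_rel I \<Longrightarrow> u - v \<in> sym2_rel I"
  using sym2_rel.add[of u I "- v"] sym2_rel.neg[of v I] by simp

lemma sym2_rel_trans: "u - v \<in> sym2_rel I \<Longrightarrow> v - w \<in> sym2_rel I \<Longrightarrow> u - w \<in> sym2_rel I"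
  using sym2_rel.add[of "u - v" I "v - w"] by simp

lemma sym2_rel_sum: "(\<And>i. i \<in> F \<Longrightarrow> f i \<in> sym2_rel I) \<Longrightarrow> (\<Sum>i\<in>F. f i) \<in> sym2_rel I"
  by (induction F rule: infinite_finite_induct) (auto simp: sym2_rel_zero intro: sym2_rel.add)

lemma sym2_rel_sum_diff:
  assumes "\<And>i. i \<in> F \<Longrightarrow> f i - g i \<in> sym2_rel I"
  shows "(\<Sum>i\<in>F. f i) - (\<Sum>i\<in>F. g i) \<in> sym2_rel I"
  unfolding sum_subtractf[symmetric] by (rule sym2_rel_sum[OF assms])

context
  fixes I :: "'a::comm_ring_1 set"
  assumes I: "is_ideal I"
begin

text \<open>\<open>fsym (x, 0)\<close> is a formal generator, not the zero function; the additivity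
  relation for \<open>0 + 0\<close> is its negative.\<close>

lemma sym2_rel_fsym_zero_right: "x \<in> I \<Longrightarrow> fsym (x, 0) \<in> sym2_rel I"
  using sym2_rel.neg[OF sym2_rel.addr[of x I 0 0]] is_ideal_zero[OF I] by simp

lemma sym2_rel_fsym_zero_left: "y \<in> I \<Longrightarrow> fsym (0, y) \<in> sym2_rel I"
  using sym2_rel.neg[OF sym2_rel.addl[of 0 I 0 y]] is_ideal_zero[OF I] by simp

lemma sym2_rel_fsym_uminus_right:
  assumes "x \<in> I" "y \<in> I"
  shows "fsym (x, - y) + fsym (x, y) \<in> sym2_rel I"
  using sym2_rel_diff[OF sym2_rel_fsym_zero_right[OF assms(1)]
      sym2_rel.addr[OF assms is_ideal_uminus[OF I assms(2)]]]
  by (simp add: algebra_simps)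

lemma sym2_rel_fsym_sum_left:
  fixes y :: "'a" and n :: nat
  assumes "\<And>i. i < n \<Longrightarrow> x i \<in> I" "y \<in> I"
  shows "fsym (\<Sum>i<n. x i, y) - (\<Sum>i<n. fsym (x i, y)) \<in> sym2_rel I"
  using assms(1)
proof (induction n)
  case 0 show ?case using sym2_rel_fsym_zero_left[OF assms(2)] by (simp only: lessThan_0 sum.empty diff_zero)
next
  case (Suc n)
  then have "(\<Sum>i<n. x i) \<in> I" by (intro is_ideal_sum[OF I]) auto
  with Suc.prems[of n] assms(2)
  have "fsym ((\<Sum>i<n. x i) + x n, y) - fsym (\<Sum>i<n. x i, y) - fsym (x n, y) \<in> sym2_rel I"
    by (intro sym2_rel.addl) auto
  moreover have "fsym (\<Sum>i<n. x i, y) - (\<Sum>i<n. fsym (x i, y)) \<in> sym2_rel I"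
    by (intro Suc.IH Suc.prems) simp
  ultimately have "(fsym ((\<Sum>i<n. x i) + x n, y) - fsym (\<Sum>i<n. x i, y) - fsym (x n, y))
      + (fsym (\<Sum>i<n. x i, y) - (\<Sum>i<n. fsym (x i, y))) \<in> sym2_rel I" by (rule sym2_rel.add)
  then show ?case by (simp add: algebra_simps)
qed

lemma sym2_rel_fsym_sum_right:
  fixes x :: "'a" and n :: nat
  assumes "\<And>i. i < n \<Longrightarrow> y i \<in> I" "x \<in> I"
  shows "fsym (x, \<Sum>i<n. y i) - (\<Sum>i<n. fsym (x, y i)) \<in> sym2_rel I"
proof -
  have "(\<Sum>i<n. y i) \<in> I" using assms(1) by (intro is_ideal_sum[OF I]) auto
  then have "fsym (x, \<Sum>i<n. y i) - fsym (\<Sum>i<n. y i, x) \<in> sym2_rel I"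
    using assms(2) by (intro sym2_rel.symm)
  moreover have "(\<Sum>i<n. fsym (y i, x)) - (\<Sum>i<n. fsym (x, y i)) \<in> sym2_rel I"
    using assms by (intro sym2_rel_sum_diff sym2_rel.symm) auto
  ultimately show ?thesis
    using sym2_rel_fsym_sum_left[of n y x] assms by (blast intro: sym2_rel_trans)
qed

end

text \<open>The counterpart of \<open>alternating_double_sum\<close> modulo relations.\<close>

lemma sym2_rel_alternating_sum:
  fixes t :: "nat \<Rightarrow> nat \<Rightarrow> 'a::comm_ring_1 \<times> 'a \<Rightarrow> int"
  assumes "\<And>i. i < n \<Longrightarrow> t i i \<in> sym2_rel I"
    and "\<And>i j. i < n \<Longrightarrow> j < n \<Longrightarrow> t i j + t j i \<in> sym2_rel I"
  shows "(\<Sum>i<n. \<Sum>j<n. t i j) \<in> sym2_rel I"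
  using assms
proof (induction n)
  case 0 show ?case using sym2_rel_zero by (simp only: lessThan_0 sum.empty)
next
  case (Suc n)
  have "(\<Sum>i<n. t i n + t n i) \<in> sym2_rel I" using Suc.prems by (intro sym2_rel_sum) auto
  moreover have "(\<Sum>i<n. \<Sum>j<n. t i j) \<in> sym2_rel I" "t n n \<in> sym2_rel I"
    using Suc by auto
  ultimately have "(\<Sum>i<n. \<Sum>j<n. t i j) + ((\<Sum>i<n. t i n + t n i) + t n n) \<in> sym2_rel I"
    by (intro sym2_rel.add)
  then show ?case by (simp only: sum.lessThan_Suc sum.distrib add_ac)
qed

text \<open>A finitely supported integer function is an integer combination of the generators on its
  support; the multiples are reached from 0 in both directions.\<close>

lemma formal_sum_induct:
  fixes f :: "'a \<times> 'a \<Rightarrow> int"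
  assumes "finite {p. f p \<noteq> 0}" "{p. f p \<noteq> 0} \<subseteq> X"
    and zero: "P 0" and add: "\<And>f g. P f \<Longrightarrow> P g \<Longrightarrow> P (f + g)" and neg: "\<And>f. P f \<Longrightarrow> P (- f)"
    and base: "\<And>p. p \<in> X \<Longrightarrow> P (fsym p)"
  shows "P f"
proof -
  have multiple: "P (\<lambda>q. k * fsym p q)" if p: "p \<in> X" for k p
  proof (induction k rule: int_induct[where k = 0])
    case base show ?case using zero by (simp add: zero_fun_def)
  next
    case (step1 k)
    have "(\<lambda>q. (k + 1) * fsym p q) = (\<lambda>q. k * fsym p q) + fsym p"
      by (auto simp: plus_fun_apply algebra_simps)
    then show ?case using add[OF step1(2) assms(6)[OF p]] by simp
  next
    case (step2 k)
    have "(\<lambda>q. (k - 1) * fsym p q) = (\<lambda>q. k * fsym p q) + - fsym p"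
      by (auto simp: plus_fun_apply uminus_apply algebra_simps)
    then show ?case using add[OF step2(2) neg[OF assms(6)[OF p]]] by simp
  qed
  have "finite F \<Longrightarrow> F \<subseteq> X \<Longrightarrow> P (\<Sum>p\<in>F. (\<lambda>q. f p * fsym p q))" for F
    by (induction F rule: finite_induct) (auto intro: zero add multiple)
  from this[OF assms(1,2)] have "P (\<Sum>p\<in>{p. f p \<noteq> 0}. (\<lambda>q. f p * fsym p q))" .
  moreover have "(\<Sum>p\<in>{p. f p \<noteq> 0}. (\<lambda>q. f p * fsym p q)) = f"
  proof
    fix q
    have "(\<Sum>p\<in>{p. f p \<noteq> 0}. f p * fsym p q) = (\<Sum>p\<in>{p. f p \<noteq> 0}. if p = q then f p else 0)"
      by (intro sum.cong refl) (auto simp: fsym_def)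
    then show "(\<Sum>p\<in>{p. f p \<noteq> 0}. (\<lambda>q. f p * fsym p q)) q = f q"
      using assms(1) by (simp add: sum_fun_apply)
  qed
  ultimately show ?thesis by simp
qed

text \<open>With \<open>x = \<Sum> r_i a_i\<close>, additivity and balancedness turn the generator
  \<open>(x, y)\<close> into the sum of the generators \<open>(a_i, r_i y)\<close>, and such sums
  are closed under addition and negation modulo relations.\<close>

lemma sym2_normal_form:
  fixes a :: "nat \<Rightarrow> 'a::comm_ring_1" and n :: nat
  defines "I \<equiv> ideal_gen (a ` {..<n})"
  assumes "finite {p. f p \<noteq> 0}" "{p. f p \<noteq> 0} \<subseteq> I \<times> I"
  obtains b where "\<And>i. b i \<in> I" "f - (\<Sum>i<n. fsym (a i, b i)) \<in> sym2_rel I"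
proof -
  note I = is_ideal_ideal_gen[of "a ` {..<n}", folded I_def]
  have aI: "a i \<in> I" if "i < n" for i unfolding I_def using that by (intro ideal_gen_base) auto
  have "\<exists>b. (\<forall>i. b i \<in> I) \<and> f - (\<Sum>i<n. fsym (a i, b i)) \<in> sym2_rel I"
    using assms(2,3)
  proof (rule formal_sum_induct)
    have "(\<Sum>i<n. fsym (a i, 0)) \<in> sym2_rel I"
      using aI by (intro sym2_rel_sum sym2_rel_fsym_zero_right[OF I]) auto
    from sym2_rel.neg[OF this]
    show "\<exists>b. (\<forall>i. b i \<in> I) \<and> 0 - (\<Sum>i<n. fsym (a i, b i)) \<in> sym2_rel I"
      using is_ideal_zero[OF I] by (intro exI[of _ "\<lambda>_. 0"]) simp
  next
    fix f g
    assume "\<exists>b. (\<forall>i. b i \<in> I) \<and> f - (\<Sum>i<n. fsym (a i, b i)) \<in> sym2_rel I"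
      and "\<exists>b. (\<forall>i. b i \<in> I) \<and> g - (\<Sum>i<n. fsym (a i, b i)) \<in> sym2_rel I"
    then obtain b c where b: "\<And>i. b i \<in> I" "f - (\<Sum>i<n. fsym (a i, b i)) \<in> sym2_rel I"
      and c: "\<And>i. c i \<in> I" "g - (\<Sum>i<n. fsym (a i, c i)) \<in> sym2_rel I" by blast
    have "(\<Sum>i<n. fsym (a i, b i + c i) - fsym (a i, b i) - fsym (a i, c i)) \<in> sym2_rel I"
      using aI b(1) c(1) by (intro sym2_rel_sum sym2_rel.addr) auto
    from sym2_rel_diff[OF sym2_rel.add[OF b(2) c(2)] this]
    have "f + g - (\<Sum>i<n. fsym (a i, b i + c i)) \<in> sym2_rel I"
      by (simp add: sum_subtractf sum.distrib algebra_simps)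
    then show "\<exists>b. (\<forall>i. b i \<in> I) \<and> f + g - (\<Sum>i<n. fsym (a i, b i)) \<in> sym2_rel I"
      using b(1) c(1) is_ideal_add[OF I] by (intro exI[of _ "\<lambda>i. b i + c i"]) simp
  next
    fix f
    assume "\<exists>b. (\<forall>i. b i \<in> I) \<and> f - (\<Sum>i<n. fsym (a i, b i)) \<in> sym2_rel I"
    then obtain b where b: "\<And>i. b i \<in> I" "f - (\<Sum>i<n. fsym (a i, b i)) \<in> sym2_rel I" by blast
    have "(\<Sum>i<n. fsym (a i, - b i) + fsym (a i, b i)) \<in> sym2_rel I"
      using aI b(1) by (intro sym2_rel_sum sym2_rel_fsym_uminus_right[OF I]) auto
    from sym2_rel.neg[OF sym2_rel.add[OF b(2) this]]
    have "- f - (\<Sum>i<n. fsym (a i, - b i)) \<in> sym2_rel I" by (simp add: sum.distrib algebra_simps)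
    then show "\<exists>b. (\<forall>i. b i \<in> I) \<and> - f - (\<Sum>i<n. fsym (a i, b i)) \<in> sym2_rel I"
      using b(1) is_ideal_uminus[OF I] by (intro exI[of _ "\<lambda>i. - b i"]) simp
  next
    fix p assume p: "p \<in> I \<times> I"
    then obtain x y where xy: "p = (x, y)" "x \<in> I" "y \<in> I" by blast
    obtain r where r: "x = (\<Sum>i<n. r i * a i)" using xy(2) unfolding I_def by (rule ideal_gen_imageE)
    have "fsym (x, y) - (\<Sum>i<n. fsym (r i * a i, y)) \<in> sym2_rel I"
      unfolding r using aI xy(3) is_ideal_mult[OF I] by (intro sym2_rel_fsym_sum_left[OF I]) auto
    moreover have "(\<Sum>i<n. fsym (r i * a i, y)) - (\<Sum>i<n. fsym (a i, r i * y)) \<in> sym2_rel I"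
      using aI xy(3) by (intro sym2_rel_sum_diff sym2_rel.scal) auto
    ultimately have "fsym p - (\<Sum>i<n. fsym (a i, r i * y)) \<in> sym2_rel I"
      unfolding xy(1) by (rule sym2_rel_trans)
    then show "\<exists>b. (\<forall>i. b i \<in> I) \<and> fsym p - (\<Sum>i<n. fsym (a i, b i)) \<in> sym2_rel I"
      using is_ideal_mult[OF I xy(3)] by (intro exI[of _ "\<lambda>i. r i * y"]) simp
  qed
  with that show thesis by blast
qed

text \<open>The second entries \<open>b\<close> of a normal form in the kernel are a syzygy with
  entries in \<open>I\<close>, hence \<open>b = M a\<close> with \<open>M\<close> alternating. The
  resulting double sum of generators then cancels in \<open>Sym^2\<close>.\<close>

lemma koszul_imp_syzygetic:
  fixes a :: "nat \<Rightarrow> 'a::comm_ring_1" and n :: nat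
  defines "I \<equiv> ideal_gen (a ` {..<n})"
  assumes koszul: "syzygies n a \<inter> ideal_freemod I n \<subseteq> koszul_syzygies n a"
  shows "syzygetic I"
  unfolding syzygetic_iff
proof (intro allI impI)
  note I = is_ideal_ideal_gen[of "a ` {..<n}", folded I_def]
  have aI: "a i \<in> I" if "i < n" for i unfolding I_def using that by (intro ideal_gen_base) auto
  fix f :: "'a \<times> 'a \<Rightarrow> int"
  assume f: "finite {p. f p \<noteq> 0}" "{p. f p \<noteq> 0} \<subseteq> I \<times> I" "formal_eval (\<lambda>p. fst p * snd p) f = 0"
  obtain b where b: "\<And>i. b i \<in> I" "f - (\<Sum>i<n. fsym (a i, b i)) \<in> sym2_rel I"
    using sym2_normal_form[of f a n] f(1,2) unfolding I_def by metis
  let ?g = "\<Sum>i<n. fsym (a i, b i)"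
  have "finite {p. ?g p \<noteq> 0}" by (intro finite_support_sum finite_support_fsym)
  then have "formal_eval (\<lambda>p. fst p * snd p) ?g = 0"
    using formal_eval_mult_sym2_rel[OF b(2)] f(1,3) by (simp add: formal_eval_diff)
  then have "(\<Sum>i<n. b i * a i) = 0"
    by (simp add: formal_eval_sum finite_support_fsym formal_eval_fsym mult.commute)
  then have "(\<lambda>i. if i < n then b i else 0) \<in> syzygies n a \<inter> ideal_freemod I n"
    using b(1) by (simp add: syzygies_def ideal_freemod_def freemod_def)
  with koszul have "(\<lambda>i. if i < n then b i else 0) \<in> koszul_syzygies n a" by blast
  then obtain M where M: "alternating M"
    "\<And>k. k < n \<Longrightarrow> (if k < n then b k else 0) = (\<Sum>j<n. M k j * a j)"
    by (rule koszul_syzygiesE) blast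
  have "(\<Sum>k<n. fsym (a k, b k)) - (\<Sum>k<n. \<Sum>j<n. fsym (a k, M k j * a j)) \<in> sym2_rel I"
  proof (rule sym2_rel_sum_diff)
    fix k assume "k \<in> {..<n}"
    then have k: "k < n" by simp
    then have "b k = (\<Sum>j<n. M k j * a j)" using M(2)[OF k] by simp
    then show "fsym (a k, b k) - (\<Sum>j<n. fsym (a k, M k j * a j)) \<in> sym2_rel I"
      using sym2_rel_fsym_sum_right[OF I, of n "\<lambda>j. M k j * a j" "a k"] aI k is_ideal_mult[OF I]
      by simp
  qed
  moreover have "(\<Sum>k<n. \<Sum>j<n. fsym (a k, M k j * a j)) \<in> sym2_rel I"
  proof (rule sym2_rel_alternating_sum)
    fix i j assume ij: "i < n" "j < n"
    \<comment> \<open>Modulo relations \<open>(a j, ?c * a i)\<close> equals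
      \<open>(?c * a i, a j)\<close> by symmetry and then \<open>(a i, ?c * a j)\<close> by
      balancedness, while \<open>M j i = - ?c\<close> supplies the opposite sign.\<close>
    let ?c = "M i j"
    have "fsym (a j, M j i * a i) + fsym (a j, ?c * a i) \<in> sym2_rel I"
      using sym2_rel_fsym_uminus_right[OF I aI[OF ij(2)] is_ideal_mult[OF I aI[OF ij(1)]], of ?c]
        alternatingD(2)[OF M(1), of j i] by simp
    moreover have "fsym (a j, ?c * a i) - fsym (?c * a i, a j) \<in> sym2_rel I"
      using aI ij is_ideal_mult[OF I] by (intro sym2_rel.symm) auto
    moreover have "fsym (?c * a i, a j) - fsym (a i, ?c * a j) \<in> sym2_rel I"
      using aI ij by (intro sym2_rel.scal) auto
    ultimately have "(fsym (a j, M j i * a i) + fsym (a j, ?c * a i)) - (fsym (a j, ?c * a i) - fsym (a i, ?c * a j))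
        \<in> sym2_rel I" by (blast intro: sym2_rel_diff sym2_rel_trans)
    then show "fsym (a i, M i j * a j) + fsym (a j, M j i * a i) \<in> sym2_rel I"
      by (simp add: algebra_simps)
  next
    fix i assume "i < n"
    then show "fsym (a i, M i i * a i) \<in> sym2_rel I"
      using sym2_rel_fsym_zero_right[OF I aI] alternatingD(1)[OF M(1)] by simp
  qed
  ultimately have "?g \<in> sym2_rel I" using sym2_rel.add by fastforce
  from sym2_rel.add[OF b(2) this] show "f \<in> sym2_rel I" by simp
qed

section \<open>Comparison of the three conditions\<close>

theorem mainTheorem11:
  fixes G :: "nat \<Rightarrow> 'a::comm_ring_1 set"
    and a :: "nat \<Rightarrow> 'a"
    and n :: nat
  assumes "noetherian_ring TYPE('a)"
    and "nat_graded G"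
    and "n \<ge> 1"
    and "grade (irrelevant G) > grade (ideal_gen (a ` {..<n}))"
    and "grade (ideal_gen (a ` {..<n})) = enat (n - 1)"
  shows "(koszul_syzygies n a = syzygies n a \<inter> ideal_freemod (ideal_gen (a ` {..<n})) n
          \<longleftrightarrow> koszul_syzygies n a = syzygies n a \<inter>
                ideal_freemod (TF (irrelevant G) (ideal_gen (a ` {..<n}))) n)
       \<and> (koszul_syzygies n a = syzygies n a \<inter>
                ideal_freemod (TF (irrelevant G) (ideal_gen (a ` {..<n}))) n
          \<longleftrightarrow> syzygetic (ideal_gen (a ` {..<n})))"
proof -
  let ?I = "ideal_gen (a ` {..<n})" and ?m = "irrelevant G"
  let ?B = "koszul_syzygies n a" and ?Z = "syzygies n a"
  note I = is_ideal_ideal_gen[of "a ` {..<n}"]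
  \<comment> \<open>The unit ideal has grade \<open>\<infinity>\<close> by convention, so a finite
    grade makes \<open>?I\<close> proper.\<close>
  have "?I \<noteq> UNIV" using assms(5) by (auto simp: grade_def)
  then obtain xs where xs: "length xs = n - 1" "weakly_regular xs" "set xs \<subseteq> ?I"
    using weakly_regular_of_grade[of "n - 1" ?I] assms(5) by auto
  have tf: "u \<in> ideal_gen (set xs)" if u: "\<And>s. s \<in> ?m \<Longrightarrow> s * u \<in> ideal_gen (set xs)" for u
  proof (cases "?m = UNIV")
    \<comment> \<open>The convention for the grade of the unit ideal provides no sequence, but
      \<open>s = 1\<close> is then available.\<close>
    case True
    then show ?thesis using u[of 1] by simp
  next
    case False
    \<comment> \<open>The strict inequality of grades yields a sequence in \<open>?m\<close> with
      one member more than \<open>xs\<close>.\<close>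
    have "enat n \<le> grade ?m" using assms(3-5) by (cases n) (auto simp: Suc_ile_eq)
    then obtain ys where "length ys = n" "weakly_regular ys" "set ys \<subseteq> ?m"
      using weakly_regular_of_grade False by blast
    then show ?thesis
      using regular_quotient_torsion_free[of ys xs u] xs u assms(3) by auto
  qed
  have sat: "?Z \<inter> ideal_freemod (TF ?m ?I) n \<subseteq> ?B" if B: "?Z \<inter> ideal_freemod ?I n \<subseteq> ?B"
  proof
    fix z assume z: "z \<in> ?Z \<inter> ideal_freemod (TF ?m ?I) n"
    then have "\<exists>k. \<forall>y\<in>ideal_pow ?m k. z i * y \<in> ?I" if "i < n" for i
      using that by (simp add: ideal_freemod_def TF_def)
    then obtain K where K: "\<And>i y. i < n \<Longrightarrow> y \<in> ideal_pow ?m (K i) \<Longrightarrow> z i * y \<in> ?I" by metis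
    \<comment> \<open>A common exponent for all entries: powers of \<open>?m\<close> decrease, so
      any upper bound of the \<open>K i\<close> serves.\<close>
    define k where "k = (\<Sum>i<n. K i)"
    have Kk: "K i \<le> k" if "i < n" for i unfolding k_def using that by (intro member_le_sum) auto
    show "z \<in> ?B"
    proof (rule koszul_syzygies_saturated[of n a ?m z k])
      fix y assume y: "y \<in> ideal_pow ?m k"
      have "y * z i \<in> ?I" if "i < n" for i
        using K[OF that] ideal_pow_antimono[OF Kk[OF that], of ?m] y by (auto simp: mult.commute)
      moreover have "(\<Sum>i<n. y * z i * a i) = y * (\<Sum>i<n. z i * a i)"
        by (simp add: sum_distrib_left mult.assoc)
      ultimately have "(\<lambda>i. y * z i) \<in> ?Z \<inter> ideal_freemod ?I n"
        using z by (simp add: syzygies_def freemod_def ideal_freemod_def)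
      then show "(\<lambda>i. y * z i) \<in> ?B" using B by blast
    next
      fix w assume w: "w \<in> ?Z" "\<And>s. s \<in> ?m \<Longrightarrow> (\<lambda>k. s * w k) \<in> ?B"
      have len: "n = Suc (length xs)" using xs(1) assms(3) by simp
      from tf w show "w \<in> ?B" by (rule koszul_syzygies_torsion_free[OF xs(2,3) len])
    qed (use z in simp)
  qed
  have sub: "?Z \<inter> ideal_freemod ?I n \<subseteq> ?Z \<inter> ideal_freemod (TF ?m ?I) n"
    using subset_TF[OF I, of ?m] by (auto simp: ideal_freemod_def)
  have "syzygetic ?I \<longleftrightarrow> ?Z \<inter> ideal_freemod ?I n \<subseteq> ?B"
    using syzygetic_imp_koszul koszul_imp_syzygetic by blast
  \<comment> \<open>\<open>?B\<close> lies in the intersection for \<open>?I\<close>, which lies in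
    the one for its saturation. So each equality amounts to an inclusion into \<open>?B\<close>:
    squeezing gives (a) from (b), and \<open>sat\<close> gives (b) from (a).\<close>
  then show ?thesis using sub sat koszul_syzygies_subset[of n a] by blast
qed

end
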